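(* Let $F$ be a field, $A$ a finitely generated free abelian group, and $F*A$ a twisted group algebra of $A$ over $F$ whose center is exactly $F$. Let $C < A$ be a subgroup containing a subgroup $C_0$ of finite index in $C$ such that $F*C_0$ is commutative. Let $M$ be a nonzero finitely generated $F*A$-module which is finitely generated as an $F*C$-module. Then: (i) $\operatorname{GKdim}(M) = \operatorname{rk}(C)$; (ii) $M$ is $F*C$-torsion-free; (iii) $M$ is artinian; (iv) $M$ is cyclic.
   Context: A twisted group algebra $F*A$ of a group $A$ over a field $F$ is the associative $F$-algebra with $F$-basis $\{\bar a : a\in A\}$ (a copy of $A$), with scalars central and multiplication $\bar a_1\bar a_2=\lambda(a_1,a_2)\overline{a_1a_2}$ for a 2-cocycle $\lambda: A\times A\to F^*$. For a subgroup $B\le A$, $F*B$ denotes the subalgebra of elements whose support (the set of $a$ with nonzero coefficient) lies in $B$; it is a domain. An $F*A$-module $M$ is $F*B$-torsion-free if no nonzero element of $M$ is annihilated by a nonzero element of $F*B$. $\operatorname{GKdim}$ denotes Gelfand–Kirillov dimension and $\operatorname{rk}$ the torsion-free rank of an abelian group. *)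

theory Defs
  imports "HOL-Analysis.Finite_Cartesian_Product" "HOL-Library.Extended_Real" "HOL-Library.Liminf_Limsup" "HOL-Library.Function_Algebras"
begin

text \<open>Twisted group algebra F*A: elements are finitely supported functions A \<Rightarrow> F,
  the basis element of a is the indicator of a; multiplication is twisted convolution.\<close>

definition fsupp :: "('a \<Rightarrow> 'k::zero) \<Rightarrow> 'a set" where
  "fsupp x = {a. x a \<noteq> 0}"

definition twalg :: "'a set \<Rightarrow> ('a \<Rightarrow> 'k::zero) set" where
  "twalg B = {x. finite (fsupp x) \<and> fsupp x \<subseteq> B}"

definition two_cocycle :: "('a::ab_group_add \<Rightarrow> 'a \<Rightarrow> 'k::field) \<Rightarrow> bool" where
  "two_cocycle lam \<longleftrightarrow> (\<forall>a b. lam a b \<noteq> 0) \<and>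
     (\<forall>a b c. lam a b * lam (a + b) c = lam b c * lam a (b + c))"

definition tw_mult :: "('a::ab_group_add \<Rightarrow> 'a \<Rightarrow> 'k::field) \<Rightarrow> ('a \<Rightarrow> 'k) \<Rightarrow> ('a \<Rightarrow> 'k) \<Rightarrow> ('a \<Rightarrow> 'k)" where
  "tw_mult lam x y = (\<lambda>c. \<Sum>a\<in>fsupp x. x a * y (c - a) * lam a (c - a))"

definition tw_scalar :: "('a::ab_group_add \<Rightarrow> 'a \<Rightarrow> 'k::field) \<Rightarrow> 'k \<Rightarrow> ('a \<Rightarrow> 'k)" where
  "tw_scalar lam c = (\<lambda>a. if a = 0 then c / lam 0 0 else 0)"

definition tw_one :: "('a::ab_group_add \<Rightarrow> 'a \<Rightarrow> 'k::field) \<Rightarrow> ('a \<Rightarrow> 'k)" where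
  "tw_one lam = tw_scalar lam 1"

definition tw_center :: "('a::ab_group_add \<Rightarrow> 'a \<Rightarrow> 'k::field) \<Rightarrow> ('a \<Rightarrow> 'k) set" where
  "tw_center lam = {z \<in> twalg UNIV. \<forall>x \<in> twalg UNIV. tw_mult lam z x = tw_mult lam x z}"

definition tw_module :: "('a::ab_group_add \<Rightarrow> 'a \<Rightarrow> 'k::field) \<Rightarrow> (('a \<Rightarrow> 'k) \<Rightarrow> 'm::ab_group_add \<Rightarrow> 'm) \<Rightarrow> bool" where
  "tw_module lam act \<longleftrightarrow>
     (\<forall>x\<in>twalg UNIV. \<forall>y\<in>twalg UNIV. \<forall>m. act (x + y) m = act x m + act y m) \<and>
     (\<forall>x\<in>twalg UNIV. \<forall>m n. act x (m + n) = act x m + act x n) \<and>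
     (\<forall>x\<in>twalg UNIV. \<forall>y\<in>twalg UNIV. \<forall>m. act (tw_mult lam x y) m = act x (act y m)) \<and>
     (\<forall>m. act (tw_one lam) m = m)"

definition submod :: "(('a \<Rightarrow> 'k) \<Rightarrow> 'm::ab_group_add \<Rightarrow> 'm) \<Rightarrow> ('a \<Rightarrow> 'k) set \<Rightarrow> 'm set \<Rightarrow> bool" where
  "submod act R N \<longleftrightarrow> 0 \<in> N \<and> (\<forall>m\<in>N. \<forall>n\<in>N. m + n \<in> N) \<and> (\<forall>m\<in>N. - m \<in> N) \<and>
     (\<forall>x\<in>R. \<forall>m\<in>N. act x m \<in> N)"

definition gen_submod :: "(('a \<Rightarrow> 'k) \<Rightarrow> 'm::ab_group_add \<Rightarrow> 'm) \<Rightarrow> ('a \<Rightarrow> 'k) set \<Rightarrow> 'm set \<Rightarrow> 'm set" where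
  "gen_submod act R S = \<Inter>{N. submod act R N \<and> S \<subseteq> N}"

definition fin_gen :: "(('a \<Rightarrow> 'k) \<Rightarrow> 'm::ab_group_add \<Rightarrow> 'm) \<Rightarrow> ('a \<Rightarrow> 'k) set \<Rightarrow> bool" where
  "fin_gen act R \<longleftrightarrow> (\<exists>S. finite S \<and> gen_submod act R S = UNIV)"

definition cyclic_mod :: "(('a \<Rightarrow> 'k) \<Rightarrow> 'm::ab_group_add \<Rightarrow> 'm) \<Rightarrow> ('a \<Rightarrow> 'k) set \<Rightarrow> bool" where
  "cyclic_mod act R \<longleftrightarrow> (\<exists>m. gen_submod act R {m} = UNIV)"

definition artinian_mod :: "(('a \<Rightarrow> 'k) \<Rightarrow> 'm::ab_group_add \<Rightarrow> 'm) \<Rightarrow> ('a \<Rightarrow> 'k) set \<Rightarrow> bool" where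
  "artinian_mod act R \<longleftrightarrow>
     \<not> (\<exists>f :: nat \<Rightarrow> 'm set. (\<forall>i. submod act R (f i)) \<and> (\<forall>i. f (Suc i) \<subset> f i))"

definition torsion_free :: "(('a \<Rightarrow> 'k::zero) \<Rightarrow> 'm::ab_group_add \<Rightarrow> 'm) \<Rightarrow> ('a \<Rightarrow> 'k) set \<Rightarrow> bool" where
  "torsion_free act R \<longleftrightarrow> (\<forall>x\<in>R. \<forall>m. x \<noteq> (\<lambda>_. 0) \<longrightarrow> act x m = 0 \<longrightarrow> m = 0)"

definition is_subgroup :: "'a::ab_group_add set \<Rightarrow> bool" where
  "is_subgroup C \<longleftrightarrow> 0 \<in> C \<and> (\<forall>a\<in>C. \<forall>b\<in>C. a + b \<in> C) \<and> (\<forall>a\<in>C. - a \<in> C)"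

definition finite_index :: "'a::ab_group_add set \<Rightarrow> 'a set \<Rightarrow> bool" where
  "finite_index C0 C \<longleftrightarrow> finite ((\<lambda>c. (\<lambda>d. c + d) ` C0) ` C)"

definition zindep :: "(int ^ 'n) set \<Rightarrow> bool" where
  "zindep S \<longleftrightarrow> (\<forall>u. (\<Sum>s\<in>S. u s *s s) = 0 \<longrightarrow> (\<forall>s\<in>S. u s = 0))"

definition tf_rank :: "(int ^ 'n) set \<Rightarrow> nat" where
  "tf_rank C = Max {card S | S. finite S \<and> S \<subseteq> C \<and> zindep S}"

definition scal :: "('a::ab_group_add \<Rightarrow> 'a \<Rightarrow> 'k::field) \<Rightarrow> (('a \<Rightarrow> 'k) \<Rightarrow> 'm \<Rightarrow> 'm) \<Rightarrow> 'k \<Rightarrow> 'm \<Rightarrow> 'm" where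
  "scal lam act c m = act (tw_scalar lam c) m"

definition F_indep :: "('a::ab_group_add \<Rightarrow> 'a \<Rightarrow> 'k::field) \<Rightarrow> (('a \<Rightarrow> 'k) \<Rightarrow> 'm::ab_group_add \<Rightarrow> 'm) \<Rightarrow> 'm set \<Rightarrow> bool" where
  "F_indep lam act S \<longleftrightarrow> (\<forall>u. (\<Sum>s\<in>S. scal lam act (u s) s) = 0 \<longrightarrow> (\<forall>s\<in>S. u s = 0))"

definition span_dim :: "('a::ab_group_add \<Rightarrow> 'a \<Rightarrow> 'k::field) \<Rightarrow> (('a \<Rightarrow> 'k) \<Rightarrow> 'm::ab_group_add \<Rightarrow> 'm) \<Rightarrow> 'm set \<Rightarrow> nat" where
  "span_dim lam act T = Max {card S | S. S \<subseteq> T \<and> F_indep lam act S}"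

text \<open>Spanning set of V^k W, where V = F-span of X and W = F-span of Y.\<close>
definition words :: "(('a \<Rightarrow> 'k) \<Rightarrow> 'm \<Rightarrow> 'm) \<Rightarrow> nat \<Rightarrow> ('a \<Rightarrow> 'k) set \<Rightarrow> 'm set \<Rightarrow> 'm set" where
  "words act k X Y = {foldr act xs y | xs y. length xs = k \<and> set xs \<subseteq> X \<and> y \<in> Y}"

text \<open>Gelfand-Kirillov dimension of an F*A-module:
  sup over finite-dimensional V \<subseteq> F*A with 1 \<in> V and finite-dimensional W \<subseteq> M of
  limsup_k log dim_F (V^k W) / log k.\<close>
definition GKdim :: "('a::ab_group_add \<Rightarrow> 'a \<Rightarrow> 'k::field) \<Rightarrow> (('a \<Rightarrow> 'k) \<Rightarrow> 'm::ab_group_add \<Rightarrow> 'm) \<Rightarrow> ereal" where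
  "GKdim lam act = (SUP XY \<in> {(X, Y). finite X \<and> X \<subseteq> twalg UNIV \<and> tw_one lam \<in> X \<and> finite Y}.
      limsup (\<lambda>k. ereal (ln (real (span_dim lam act (words act k (fst XY) (snd XY)))) / ln (real k))))"

end

theory Submission
  imports Defs "HOL-Computational_Algebra.Polynomial" "HOL-Real_Asymp.Real_Asymp"
begin

text \<open>
  Write \<open>U\<^sub>a\<close> for the action of the basis element of \<open>a\<close> and \<open>chi\<close> for the commutator pairing of the
  cocycle. That the center is \<open>F\<close> says that \<open>chi\<close> is nondegenerate; hence a nonzero subspace of \<open>F*B\<close>
  that is stable under conjugation by \<open>A\<close> and under multiplication by \<open>F*B\<close> contains \<open>1\<close> (take an
  element of minimal support). For a submodule \<open>N\<close>, the torsion of \<open>M/N\<close> over the commutative domain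
  \<open>F*C\<^sub>0\<close> has a nonzero annihilator, which is such a subspace, so \<open>M/N\<close> is torsion-free. Therefore
  the \<open>F*C\<^sub>0\<close>-rank strictly increases along inclusions of submodules, which gives the descending chain
  condition. The group \<open>C\<^sub>0\<close> has infinite index, so every element of \<open>M\<close> has a nonzero annihilator in the
  simple ring \<open>F*A\<close>, and the usual argument for modules of finite length over simple rings shows that
  \<open>M\<close> is cyclic. The growth of \<open>M\<close> is that of \<open>C\<close>: at most, because \<open>U\<^sub>a\<close> commutes up to scalars with
  the action of \<open>C\<close> on finitely many generators, and at least, because \<open>M\<close> is torsion-free.
\<close>

section \<open>Twisted group algebras\<close>

text \<open>The natural home of ranks over F*C_0 is a vector space over its field of fractions.
  Dimensions over F are counted instead: iterated sumsets in a lattice grow polynomially, so the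
  ratio of consecutive sizes comes arbitrarily close to 1, and this turns a bound on dimensions into
  a bound on families independent over F*B. The count is valid for noncommutative F*B as well, hence
  for F*C acting on itself, and this is how torsion-freeness passes from F*C_0 to F*C. Conjugation
  by a basis element only rescales coefficients and so preserves F*B for every subgroup B. For this
  reason torsion over F*C_0, an object attached to a small subgroup, is stable under all of A. The
  obstacle to a direct use of simplicity is that torsion has to be bounded by one common annihilator
  before elements of minimal support can be considered; a maximal independent set of generators
  provides it. Strict growth of a bounded rank also supplies the maximal and minimal submodules in
  the proof of cyclicity, so no composition series is formed.\<close>

definition bas :: "'a \<Rightarrow> 'a \<Rightarrow> 'k::zero_neq_one" where
  "bas a = (\<lambda>b. if b = a then 1 else 0)"

lemma twalg_imp_finite: "x \<in> twalg B \<Longrightarrow> finite (fsupp x)"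
  by (simp add: twalg_def)

lemma twalg_mono: "x \<in> twalg B \<Longrightarrow> B \<subseteq> D \<Longrightarrow> x \<in> twalg D"
  by (auto simp: twalg_def)

lemma twalg_UNIV_I [intro]: "x \<in> twalg B \<Longrightarrow> x \<in> twalg UNIV"
  by (auto simp: twalg_def)

lemma twalg_outside: "x \<in> twalg B \<Longrightarrow> a \<notin> B \<Longrightarrow> x a = 0"
  by (auto simp: twalg_def fsupp_def)

lemma twalgI_finite: "finite D \<Longrightarrow> D \<subseteq> B \<Longrightarrow> (\<And>a. a \<notin> D \<Longrightarrow> x a = 0) \<Longrightarrow> x \<in> twalg B"
  unfolding twalg_def fsupp_def by (auto intro: finite_subset[of _ D])

lemma twalg_zero [simp]: "(\<lambda>_. 0) \<in> twalg B"
  by (simp add: twalg_def fsupp_def)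

lemma twalg_bas: "a \<in> B \<Longrightarrow> bas a \<in> twalg B"
  by (rule twalgI_finite[of "{a}"]) (auto simp: bas_def)

lemma twalg_bas_UNIV [simp]: "bas a \<in> twalg UNIV"
  by (simp add: twalg_bas)

lemma twalg_add: "x \<in> twalg B \<Longrightarrow> y \<in> twalg B \<Longrightarrow> x + (y :: _ \<Rightarrow> _::field) \<in> twalg B"
  by (rule twalgI_finite[of "fsupp x \<union> fsupp y"]) (auto simp: twalg_def fsupp_def)

lemma twalg_diff: "x \<in> twalg B \<Longrightarrow> y \<in> twalg B \<Longrightarrow> x - (y :: _ \<Rightarrow> _::field) \<in> twalg B"
  by (rule twalgI_finite[of "fsupp x \<union> fsupp y"]) (auto simp: twalg_def fsupp_def)

lemma twalg_pointwise: "x \<in> twalg B \<Longrightarrow> (\<lambda>b. c b * (x b :: _::field)) \<in> twalg B"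
  by (rule twalgI_finite[of "fsupp x"]) (auto simp: twalg_def fsupp_def)

lemma twalg_sum: "(\<And>i. i \<in> I \<Longrightarrow> f i \<in> twalg B) \<Longrightarrow> (\<Sum>i\<in>I. f i :: _ \<Rightarrow> _::field) \<in> twalg B"
proof (induction I rule: infinite_finite_induct)
  case (insert i I)
  then have "f i + sum f I \<in> twalg B" by (intro twalg_add) auto
  then show ?case unfolding sum.insert[OF insert.hyps] .
qed (simp_all add: zero_fun_def)

lemma is_subgroup_add: "is_subgroup B \<Longrightarrow> a \<in> B \<Longrightarrow> b \<in> B \<Longrightarrow> a + b \<in> B"
  and is_subgroup_uminus: "is_subgroup B \<Longrightarrow> a \<in> B \<Longrightarrow> - a \<in> B"
  and is_subgroup_zero: "is_subgroup B \<Longrightarrow> 0 \<in> B"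
  by (auto simp: is_subgroup_def)

lemma is_subgroup_diff: "is_subgroup B \<Longrightarrow> a \<in> B \<Longrightarrow> b \<in> B \<Longrightarrow> a - b \<in> B"
  using is_subgroup_add[of B a "- b"] is_subgroup_uminus[of B b] by simp

lemma is_subgroup_UNIV [simp]: "is_subgroup UNIV"
  by (simp add: is_subgroup_def)

text \<open>\<open>tw_mult\<close> sums over the exact support, which changes under addition.
  Padding the index set to a finite superset gives different elements a common index set, as
  bilinearity and reindexing require.\<close>

lemma tw_mult_eq:
  assumes "finite S" "fsupp x \<subseteq> S"
  shows "tw_mult lam x y c = (\<Sum>a\<in>S. x a * y (c - a) * lam a (c - a))"
  unfolding tw_mult_def using assms by (intro sum.mono_neutral_left) (auto simp: fsupp_def)

lemma fsupp_bas: "fsupp (bas a :: _ \<Rightarrow> 'k::zero_neq_one) = {a}"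
  by (auto simp: fsupp_def bas_def)

lemma bas_mult: "tw_mult lam (bas a) y = (\<lambda>c. y (c - a) * lam a (c - a))"
  by (simp add: tw_mult_def fsupp_bas) (simp add: bas_def)

lemma mult_bas:
  assumes "x \<in> twalg UNIV"
  shows "tw_mult lam x (bas b) = (\<lambda>c. x (c - b) * lam (c - b) b)"
proof
  fix c
  have f: "finite (insert (c - b) (fsupp x))" using assms by (simp add: twalg_def)
  have "tw_mult lam x (bas b) c = (\<Sum>a\<in>insert (c - b) (fsupp x). x a * bas b (c - a) * lam a (c - a))"
    using f by (intro tw_mult_eq) auto
  also have "\<dots> = (\<Sum>a\<in>insert (c - b) (fsupp x). if a = c - b then x a * lam a (c - a) else 0)"
    by (intro sum.cong refl) (auto simp: bas_def algebra_simps)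
  also have "\<dots> = x (c - b) * lam (c - b) b"
    using f by (simp only: sum.delta) simp
  finally show "tw_mult lam x (bas b) c = x (c - b) * lam (c - b) b" .
qed

lemma twalg_mult:
  assumes B: "is_subgroup B" and x: "x \<in> twalg B" and y: "y \<in> twalg B"
  shows "tw_mult lam x y \<in> twalg B"
proof (rule twalgI_finite[of "(\<lambda>(a,b). a + b) ` (fsupp x \<times> fsupp y)"])
  show "finite ((\<lambda>(a, b). a + b) ` (fsupp x \<times> fsupp y))" using x y by (auto simp: twalg_def)
  show "(\<lambda>(a, b). a + b) ` (fsupp x \<times> fsupp y) \<subseteq> B"
    using x y B by (auto simp: twalg_def intro!: is_subgroup_add)
  fix c assume c: "c \<notin> (\<lambda>(a, b). a + b) ` (fsupp x \<times> fsupp y)"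
  have "y (c - a) = 0" if "a \<in> fsupp x" for a
  proof (rule ccontr)
    assume "y (c - a) \<noteq> 0"
    then have "(a, c - a) \<in> fsupp x \<times> fsupp y" using that by (auto simp: fsupp_def)
    then have "(\<lambda>(a,b). a + b) (a, c - a) \<in> (\<lambda>(a, b). a + b) ` (fsupp x \<times> fsupp y)" by (rule imageI)
    then show False using c by simp
  qed
  then show "tw_mult lam x y c = 0" by (simp add: tw_mult_def)
qed

lemma tw_mult_add_left:
  assumes "x \<in> twalg UNIV" "y \<in> twalg UNIV"
  shows "tw_mult lam (x + y) z = tw_mult lam x z + tw_mult lam y z"
proof
  fix c
  have f: "finite (fsupp x \<union> fsupp y)" using assms by (simp add: twalg_def)
  have s: "fsupp (x + y) \<subseteq> fsupp x \<union> fsupp y" by (auto simp: fsupp_def)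
  show "tw_mult lam (x + y) z c = (tw_mult lam x z + tw_mult lam y z) c"
    using tw_mult_eq[OF f s, of lam z c] tw_mult_eq[OF f, of x lam z c] tw_mult_eq[OF f, of y lam z c]
    by (simp add: sum.distrib[symmetric] distrib_right)
qed

lemma tw_mult_add_right: "tw_mult lam x (y + z) = tw_mult lam x y + tw_mult lam x z"
  by (rule ext) (simp add: tw_mult_def sum.distrib[symmetric] distrib_left distrib_right)

locale cocycle =
  fixes lam :: "'a::ab_group_add \<Rightarrow> 'a \<Rightarrow> 'k::field"
  assumes two_cocycle: "two_cocycle lam"
begin

lemma lam_nz [simp]: "lam a b \<noteq> 0"
  using two_cocycle by (simp add: two_cocycle_def)

lemma lam_assoc: "lam a b * lam (a + b) c = lam b c * lam a (b + c)"
  using two_cocycle by (simp add: two_cocycle_def)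

text \<open>The cocycle is not normalised: the basis element of 0 is \<open>lam 0 0\<close> times
  the identity. This constant reappears wherever \<open>U 0\<close> or an inverse of some
  \<open>U a\<close> is computed.\<close>

lemma lam_0_left: "lam 0 b = lam 0 0"
  using lam_assoc[of 0 0 b] by simp

lemma lam_0_right: "lam a 0 = lam 0 0"
  using lam_assoc[of a 0 0] by simp

text \<open>For fixed \<open>a\<close> the substitution \<open>p = a + b\<close> turns the sum over
  the sumset of the supports into a sum over the second factor. What remains is the cocycle identity
  at \<open>a\<close>, \<open>b\<close> and \<open>c - a - b\<close>.\<close>

lemma tw_mult_assoc:
  assumes x: "x \<in> twalg UNIV" and y: "y \<in> twalg UNIV"
  shows "tw_mult lam (tw_mult lam x y) z = tw_mult lam x (tw_mult lam y z)"
proof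
  fix c
  let ?P = "(\<lambda>(a,b). a + b) ` (fsupp x \<times> fsupp y)"
  have P: "finite ?P" using x y by (auto simp: twalg_def)
  have sub: "fsupp (tw_mult lam x y) \<subseteq> ?P"
  proof
    fix c assume "c \<in> fsupp (tw_mult lam x y)"
    then obtain a where "a \<in> fsupp x" "x a * y (c - a) * lam a (c - a) \<noteq> 0"
      unfolding fsupp_def tw_mult_def by (auto elim: sum.not_neutral_contains_not_neutral)
    then have "(a, c - a) \<in> fsupp x \<times> fsupp y" by (auto simp: fsupp_def)
    then have "(\<lambda>(a,b). a + b) (a, c - a) \<in> ?P" by (rule imageI)
    then show "c \<in> ?P" by simp
  qed
  have "tw_mult lam (tw_mult lam x y) z c = (\<Sum>p\<in>?P. tw_mult lam x y p * z (c - p) * lam p (c - p))"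
    by (rule tw_mult_eq[OF P sub])
  also have "\<dots> = (\<Sum>a\<in>fsupp x. \<Sum>p\<in>?P. x a * y (p - a) * lam a (p - a) * z (c - p) * lam p (c - p))"
    by (subst sum.swap) (simp add: tw_mult_def sum_distrib_right)
  also have "\<dots> = (\<Sum>a\<in>fsupp x. x a * tw_mult lam y z (c - a) * lam a (c - a))"
  proof (rule sum.cong[OF refl])
    fix a assume a: "a \<in> fsupp x"
    let ?D = "(\<lambda>p. p - a) ` ?P"
    have D: "finite ?D" using P by simp
    have sD: "fsupp y \<subseteq> ?D"
    proof
      fix b assume "b \<in> fsupp y"
      then have "(\<lambda>(a,b). a + b) (a, b) \<in> ?P" using a by (intro imageI) auto
      then have "a + b - a \<in> ?D" by (intro imageI) simp
      then show "b \<in> ?D" by simp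
    qed
    have "(\<Sum>p\<in>?P. x a * y (p - a) * lam a (p - a) * z (c - p) * lam p (c - p))
        = (\<Sum>b\<in>?D. x a * y b * lam a b * z (c - (a + b)) * lam (a + b) (c - (a + b)))"
      by (subst sum.reindex) (auto simp: inj_on_def)
    also have "\<dots> = (\<Sum>b\<in>?D. x a * (y b * z (c - a - b) * lam b (c - a - b)) * lam a (c - a))"
    proof (rule sum.cong[OF refl])
      fix b
      have "lam a b * lam (a + b) (c - (a + b)) = lam b (c - a - b) * lam a (c - a)"
        using lam_assoc[of a b "c - (a + b)"] by (simp add: algebra_simps)
      then show "x a * y b * lam a b * z (c - (a + b)) * lam (a + b) (c - (a + b)) =
         x a * (y b * z (c - a - b) * lam b (c - a - b)) * lam a (c - a)"
        by (simp add: diff_diff_eq mult.assoc)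
    qed
    also have "\<dots> = x a * tw_mult lam y z (c - a) * lam a (c - a)"
      by (simp add: tw_mult_eq[OF D sD] sum_distrib_left sum_distrib_right)
    finally show "(\<Sum>p\<in>?P. x a * y (p - a) * lam a (p - a) * z (c - p) * lam p (c - p))
       = x a * tw_mult lam y z (c - a) * lam a (c - a)" .
  qed
  also have "\<dots> = tw_mult lam x (tw_mult lam y z) c" by (simp add: tw_mult_def)
  finally show "tw_mult lam (tw_mult lam x y) z c = tw_mult lam x (tw_mult lam y z) c" .
qed

lemma tw_scalar_eq: "tw_scalar lam c = (\<lambda>b. c / lam 0 0 * bas 0 b)"
  by (auto simp: tw_scalar_def bas_def)

lemma tw_scalar_in: "0 \<in> B \<Longrightarrow> tw_scalar lam c \<in> twalg B"
  unfolding tw_scalar_eq by (intro twalg_pointwise twalg_bas)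

lemma tw_scalar_UNIV [simp]: "tw_scalar lam c \<in> twalg UNIV"
  by (simp add: tw_scalar_in)

lemma tw_one_UNIV [simp]: "tw_one lam \<in> twalg UNIV"
  by (simp add: tw_one_def)

lemma tw_scalar_mult: "tw_mult lam (tw_scalar lam c) y = (\<lambda>b. c * y b)"
proof
  fix b
  have "tw_mult lam (tw_scalar lam c) y b = (\<Sum>a\<in>{0}. tw_scalar lam c a * y (b - a) * lam a (b - a))"
    by (rule tw_mult_eq) (auto simp: fsupp_def tw_scalar_def)
  then show "tw_mult lam (tw_scalar lam c) y b = c * y b" using lam_0_left[of b] by (simp add: tw_scalar_def)
qed

lemma tw_mult_one: "tw_mult lam (tw_one lam) y = y"
  by (simp add: tw_one_def tw_scalar_mult)

lemma bas_mult_bas: "tw_mult lam (bas a) (bas b) = (\<lambda>c. lam a b * bas (a + b) c)"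
  unfolding bas_mult by (rule ext) (auto simp: bas_def algebra_simps)

lemma bas_mult_scalar: "tw_mult lam (bas a) (tw_scalar lam c) = (\<lambda>b. c * bas a b)"
  unfolding bas_mult by (rule ext) (auto simp: bas_def tw_scalar_def lam_0_right[of a])

text \<open>The regular module. It makes statements about modules, above all the counting bound,
  available for the algebra itself.\<close>

lemma tw_module_mult: "tw_module lam (tw_mult lam)"
  unfolding tw_module_def
  by (auto simp: tw_mult_add_left tw_mult_add_right tw_mult_assoc tw_mult_one)

text \<open>The commutator pairing: conjugation by the basis element of \<open>a\<close> multiplies the basis
  element of \<open>b\<close> by \<open>chi a b\<close>.\<close>

definition chi :: "'a \<Rightarrow> 'a \<Rightarrow> 'k" where
  "chi a b = lam a b / lam b a"

definition conj :: "'a \<Rightarrow> ('a \<Rightarrow> 'k) \<Rightarrow> 'a \<Rightarrow> 'k" where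
  "conj a x = (\<lambda>b. chi a b * x b)"

lemma chi_nz [simp]: "chi a b \<noteq> 0"
  by (simp add: chi_def)

lemma chi_0_right [simp]: "chi a 0 = 1"
  using lam_0_left[of a] lam_0_right[of a] by (simp add: chi_def)

lemma chi_0_left [simp]: "chi 0 a = 1"
  using lam_0_left[of a] lam_0_right[of a] by (simp add: chi_def)

lemma chi_sym: "chi b a = inverse (chi a b)"
  by (simp add: chi_def)

lemma chi_eq_1: "chi a b = 1 \<longleftrightarrow> lam a b = lam b a"
  by (simp add: chi_def)

lemma chi_add_left: "chi (a + a') b = chi a b * chi a' b"
proof -
  have 1: "lam a a' * lam (a + a') b = lam a' b * lam a (a' + b)" by (rule lam_assoc)
  have 2: "lam b a * lam (a + b) a' = lam a a' * lam b (a + a')"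
    using lam_assoc[of b a a'] by (simp add: add.commute)
  have 3: "lam a b * lam (a + b) a' = lam b a' * lam a (a' + b)"
    using lam_assoc[of a b a'] by (simp add: add.commute)
  \<comment> \<open>The common factor collects the values of \<open>lam\<close> that occur in the
    three cocycle identities but not in the claim; it is nonzero and cancels.\<close>
  have "(lam a a' * lam (a + b) a' * lam a (a' + b)) * (lam (a + a') b * (lam b a * lam b a'))
      = (lam a a' * lam (a + a') b) * (lam b a * lam (a + b) a') * (lam b a' * lam a (a' + b))"
    by (simp add: ac_simps)
  also have "\<dots> = (lam a a' * lam (a + b) a' * lam a (a' + b)) * (lam a b * lam a' b * lam b (a + a'))"
    unfolding 1 2 3[symmetric] by (simp add: ac_simps)
  finally have "lam (a + a') b * (lam b a * lam b a') = lam a b * lam a' b * lam b (a + a')"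
    by simp
  then show ?thesis unfolding chi_def by (simp add: field_simps)
qed

lemma twalg_conj: "x \<in> twalg B \<Longrightarrow> conj a x \<in> twalg B"
  unfolding conj_def by (rule twalg_pointwise)

lemma conj_eq_0: "conj a x = (\<lambda>_. 0) \<longleftrightarrow> x = (\<lambda>_. 0)"
  by (auto simp: conj_def fun_eq_iff)

lemma bas_mult_conj:
  assumes "x \<in> twalg UNIV"
  shows "tw_mult lam (bas a) x = tw_mult lam (conj a x) (bas a)"
  unfolding bas_mult mult_bas[OF twalg_conj[OF assms]]
  by (rule ext) (simp add: conj_def chi_def)

lemma tw_mult_commute:
  assumes x: "x \<in> twalg B" and y: "y \<in> twalg B" and c: "\<And>a b. a \<in> B \<Longrightarrow> b \<in> B \<Longrightarrow> lam a b = lam b a"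
  shows "tw_mult lam x y = tw_mult lam y x"
proof
  fix p
  \<comment> \<open>\<open>D\<close> contains the support of \<open>x\<close> and its reflection
    \<open>p - D\<close> contains that of \<open>y\<close>, so one set serves both products.\<close>
  define D where "D = fsupp x \<union> (\<lambda>b. p - b) ` fsupp y"
  have D: "finite D" using x y by (auto simp: D_def twalg_def)
  have "tw_mult lam x y p = (\<Sum>a\<in>D. x a * y (p - a) * lam a (p - a))"
    using D by (intro tw_mult_eq) (auto simp: D_def)
  also have "\<dots> = (\<Sum>a\<in>D. y (p - a) * x (p - (p - a)) * lam (p - a) (p - (p - a)))"
  proof (rule sum.cong[OF refl])
    fix a
    show "x a * y (p - a) * lam a (p - a) = y (p - a) * x (p - (p - a)) * lam (p - a) (p - (p - a))"
      using twalg_outside[OF x, of a] twalg_outside[OF y, of "p - a"] c[of a "p - a"]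
      by (cases "a \<in> B \<and> p - a \<in> B") auto
  qed
  also have "\<dots> = (\<Sum>b\<in>(\<lambda>a. p - a) ` D. y b * x (p - b) * lam b (p - b))"
    by (subst sum.reindex) (auto simp: inj_on_def)
  also have "\<dots> = tw_mult lam y x p"
    using D twalg_imp_finite[OF y] by (intro tw_mult_eq[symmetric]) (auto simp: D_def image_Un image_image)
  finally show "tw_mult lam x y p = tw_mult lam y x p" .
qed

end

section \<open>Absence of zero divisors\<close>

definition dom_alg :: "('a::ab_group_add \<Rightarrow> 'a \<Rightarrow> 'k::field) \<Rightarrow> bool" where
  "dom_alg lam \<longleftrightarrow> (\<forall>x\<in>twalg UNIV. \<forall>y\<in>twalg UNIV. tw_mult lam x y = (\<lambda>_. 0) \<longrightarrow> x = (\<lambda>_. 0) \<or> y = (\<lambda>_. 0))"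

text \<open>The leading terms with respect to the order pulled back along \<open>phi\<close>
  multiply to a term that no other pair of terms reaches, so it cannot cancel.\<close>

lemma (in cocycle) dom_alg_ordered:
  fixes phi :: "'a \<Rightarrow> 'o::linordered_ab_group_add"
  assumes inj: "inj phi" and diff: "\<And>a b. phi (a - b) = phi a - phi b"
  shows "dom_alg lam"
  unfolding dom_alg_def
proof (intro ballI impI, rule ccontr)
  have max: "\<exists>a. x a \<noteq> 0 \<and> (\<forall>b. x b \<noteq> 0 \<longrightarrow> b \<noteq> a \<longrightarrow> phi b < phi a)"
    if x: "x \<in> twalg UNIV" "x \<noteq> (\<lambda>_. 0)" for x :: "'a \<Rightarrow> 'k"
  proof -
    have ne: "fsupp x \<noteq> {}" "finite (fsupp x)" using x by (auto simp: fsupp_def twalg_def)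
    then obtain a where a: "a \<in> fsupp x" "phi a = Max (phi ` fsupp x)"
      by (metis (no_types, lifting) Max_in finite_imageI image_iff image_is_empty)
    have "phi b < phi a" if "b \<in> fsupp x" "b \<noteq> a" for b
      using ne a that inj by (metis Max_ge finite_imageI image_eqI injD order_less_le)
    then show ?thesis using a by (auto simp: fsupp_def)
  qed
  fix x y :: "'a \<Rightarrow> 'k"
  assume x: "x \<in> twalg UNIV" and y: "y \<in> twalg UNIV" and z: "tw_mult lam x y = (\<lambda>_. 0)"
    and n: "\<not> (x = (\<lambda>_. 0) \<or> y = (\<lambda>_. 0))"
  obtain a where a: "x a \<noteq> 0" "\<And>b. x b \<noteq> 0 \<Longrightarrow> b \<noteq> a \<Longrightarrow> phi b < phi a" using max[OF x] n by auto
  obtain b where b: "y b \<noteq> 0" "\<And>c. y c \<noteq> 0 \<Longrightarrow> c \<noteq> b \<Longrightarrow> phi c < phi b" using max[OF y] n by auto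
  have "tw_mult lam x y (a + b) = (\<Sum>c\<in>fsupp x. x c * y (a + b - c) * lam c (a + b - c))"
    by (simp add: tw_mult_def)
  also have "\<dots> = (\<Sum>c\<in>fsupp x. if c = a then x a * y b * lam a b else 0)"
  proof (rule sum.cong[OF refl])
    fix c assume c: "c \<in> fsupp x"
    have "y (a + b - c) = 0" if "c \<noteq> a"
    proof (rule ccontr)
      assume "y (a + b - c) \<noteq> 0"
      moreover have "a + b - c \<noteq> b" using that by (simp add: algebra_simps)
      ultimately have "phi (a + b - c) < phi b" using b by blast
      moreover have "phi (a + b - c) = phi a - (phi c - phi b)"
        unfolding diff[symmetric] by (simp add: algebra_simps)
      ultimately have "phi a < phi c" by (simp add: algebra_simps)
      then show False using a(2)[of c] c that by (auto simp: fsupp_def)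
    qed
    then show "x c * y (a + b - c) * lam c (a + b - c) = (if c = a then x a * y b * lam a b else 0)"
      by auto
  qed
  also have "\<dots> = x a * y b * lam a b"
    using x a by (simp add: twalg_def) (simp add: fsupp_def)
  also have "\<dots> \<noteq> 0" using a b by simp
  finally show False using z by simp
qed

lemma (in cocycle) dom_algD:
  assumes "dom_alg lam" "x \<in> twalg UNIV" "y \<in> twalg UNIV" "tw_mult lam x y = (\<lambda>_. 0)"
  shows "x = (\<lambda>_. 0) \<or> y = (\<lambda>_. 0)"
  using assms unfolding dom_alg_def by blast

text \<open>Integer polynomials are ordered by the sign of the leading coefficient of a difference.
  Sending the coordinates to distinct monomials embeds the lattice into this ordered group, which
  amounts to a lexicographic order.\<close>

lemma dom_alg_int_vec:
  fixes lam :: "int ^ 'n \<Rightarrow> int ^ 'n \<Rightarrow> 'k::field"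
  assumes "two_cocycle lam"
  shows "dom_alg lam"
proof -
  interpret cocycle lam by unfold_locales (rule assms)
  obtain idx :: "'n \<Rightarrow> nat" where idx: "inj idx"
    using finite_imp_inj_to_nat_seg[of "UNIV :: 'n set"] by auto
  define phi :: "int ^ 'n \<Rightarrow> int poly" where "phi v = (\<Sum>i\<in>UNIV. monom (v $ i) (idx i))" for v
  have c: "poly.coeff (phi v) (idx i) = v $ i" for v i
  proof -
    have "poly.coeff (phi v) (idx i) = (\<Sum>j\<in>UNIV. if j = i then v $ j else 0)"
      using idx by (auto simp: phi_def coeff_sum inj_eq intro!: sum.cong)
    then show ?thesis by simp
  qed
  show ?thesis
  proof (rule dom_alg_ordered[of phi])
    show "inj phi"
    proof (rule injI)
      fix v w assume "phi v = phi w"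
      then have "v $ i = w $ i" for i by (metis c)
      then show "v = w" by (simp add: vec_eq_iff)
    qed
  qed (simp add: phi_def sum_subtractf diff_monom[symmetric])
qed

section \<open>Modules over twisted group algebras\<close>

primrec nsum :: "'a::ab_group_add set \<Rightarrow> nat \<Rightarrow> 'a set" where
  "nsum Q 0 = {0}"
| "nsum Q (Suc k) = (\<lambda>(a, b). a + b) ` (nsum Q k \<times> Q)"

lemma finite_nsum: "finite Q \<Longrightarrow> finite (nsum Q k)"
  by (induction k) auto

lemma nsum_subset: "is_subgroup B \<Longrightarrow> Q \<subseteq> B \<Longrightarrow> nsum Q k \<subseteq> B"
  by (induction k) (auto simp: is_subgroup_zero intro!: is_subgroup_add)

lemma nsum_Suc_I: "a \<in> nsum Q k \<Longrightarrow> q \<in> Q \<Longrightarrow> a + q \<in> nsum Q (Suc k)"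
  by auto

text \<open>A form of the Foelner condition: at some stage one more summand from \<open>Q\<close>
  enlarges the sumset by a factor below 1 + 1/s. The inequality is multiplied out to stay within the
  natural numbers.\<close>

definition slow_growth :: "'a::ab_group_add set \<Rightarrow> bool" where
  "slow_growth B \<longleftrightarrow> (\<forall>Q s. finite Q \<longrightarrow> Q \<noteq> {} \<longrightarrow> Q \<subseteq> B \<longrightarrow>
     (\<exists>k. s * card (nsum Q (Suc k)) < Suc s * card (nsum Q k)))"

lemma (in cocycle) tw_one_in_conj_invariant:
  assumes nondeg: "\<And>b. (\<And>a. lam a b = lam b a) \<Longrightarrow> b = 0"
    and B: "is_subgroup B" and JB: "J \<subseteq> twalg B"
    and diff: "\<And>x y. x \<in> J \<Longrightarrow> y \<in> J \<Longrightarrow> x - y \<in> J"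
    and scale: "\<And>c x. x \<in> J \<Longrightarrow> (\<lambda>b. c * x b) \<in> J"
    and cj: "\<And>a x. x \<in> J \<Longrightarrow> conj a x \<in> J"
    and left: "\<And>b x. b \<in> B \<Longrightarrow> x \<in> J \<Longrightarrow> tw_mult lam (bas b) x \<in> J"
    and ne: "z0 \<in> J" "z0 \<noteq> (\<lambda>_. 0)"
  shows "tw_one lam \<in> J"
proof -
  obtain z where z: "z \<in> J \<and> z \<noteq> (\<lambda>_. 0)"
    and zmin': "\<forall>x. x \<in> J \<and> x \<noteq> (\<lambda>_. 0) \<longrightarrow> card (fsupp z) \<le> card (fsupp x)"
    using ex_has_least_nat[of "\<lambda>x. x \<in> J \<and> x \<noteq> (\<lambda>_. 0)" z0 "\<lambda>x. card (fsupp x)", OF conjI[OF ne]]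
    by (elim exE conjE) (rule that[OF conjI])
  have zmin: "card (fsupp z) \<le> card (fsupp x)" if "x \<in> J" "x \<noteq> (\<lambda>_. 0)" for x
    using zmin' that by simp
  obtain b where b: "z b \<noteq> 0" using z by auto
  have bB: "b \<in> B" using b z JB by (auto simp: twalg_def fsupp_def)
  \<comment> \<open>Translation by \<open>- b\<close> keeps the size of the support and brings 0
    into it, a position whose coefficient every conjugation fixes.\<close>
  define y where "y = tw_mult lam (bas (- b)) z"
  have yJ: "y \<in> J" unfolding y_def using z bB B by (intro left) (auto intro: is_subgroup_uminus)
  have y_eq: "y c = z (c + b) * lam (- b) (c + b)" for c by (simp add: y_def bas_mult)
  have ysupp: "fsupp y = (\<lambda>c. c - b) ` fsupp z"
    by (auto simp: fsupp_def y_eq image_iff) (metis add_diff_cancel_right')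
  have fz: "finite (fsupp z)" using z JB by (auto simp: twalg_def)
  have cy: "card (fsupp y) = card (fsupp z)"
    unfolding ysupp by (rule card_image) (auto simp: inj_on_def)
  have y0: "y 0 \<noteq> 0" using b by (simp add: y_eq)
  have fy: "finite (fsupp y)" using ysupp fz by simp
  have inv: "conj a y = y" for a
  proof (rule ccontr)
    assume "conj a y \<noteq> y"
    then have n: "conj a y - y \<noteq> (\<lambda>_. 0)" by (auto simp: fun_eq_iff)
    \<comment> \<open>Position 0 is lost because \<open>chi a 0 = 1\<close>, so a nonzero difference
      would contradict the minimality of \<open>z\<close>.\<close>
    have "fsupp (conj a y - y) \<subseteq> fsupp y - {0}" by (auto simp: fsupp_def conj_def)
    then have "fsupp (conj a y - y) \<subset> fsupp y" using y0 by (auto simp: fsupp_def)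
    then have "card (fsupp (conj a y - y)) < card (fsupp y)" using fy by (intro psubset_card_mono)
    moreover have "card (fsupp z) \<le> card (fsupp (conj a y - y))"
      by (rule zmin) (use n yJ cj diff in auto)
    ultimately show False using cy by simp
  qed
  have "y c = 0" if "c \<noteq> 0" for c
  proof (rule ccontr)
    assume c: "y c \<noteq> 0"
    have "chi a c = 1" for a using fun_cong[OF inv[of a], of c] c by (simp add: conj_def)
    then show False using nondeg[of c] that by (simp add: chi_eq_1)
  qed
  then have "tw_one lam = (\<lambda>c. inverse (y 0 * lam 0 0) * y c)"
    using y0 by (auto simp: fun_eq_iff tw_one_def tw_scalar_def field_simps)
  then show ?thesis using scale[OF yJ] by simp
qed

section \<open>Modules and the operators of basis elements\<close>

locale twmod = cocycle lam for lam :: "'a::ab_group_add \<Rightarrow> 'a \<Rightarrow> 'k::field" +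
  fixes act :: "('a \<Rightarrow> 'k) \<Rightarrow> 'm::ab_group_add \<Rightarrow> 'm"
  assumes tw_module: "tw_module lam act"
begin

abbreviation scl :: "'k \<Rightarrow> 'm \<Rightarrow> 'm" where "scl \<equiv> scal lam act"

definition U :: "'a \<Rightarrow> 'm \<Rightarrow> 'm" where "U a m = act (bas a) m"

lemma act_add_left: "x \<in> twalg UNIV \<Longrightarrow> y \<in> twalg UNIV \<Longrightarrow> act (x + y) m = act x m + act y m"
  and act_add_right: "x \<in> twalg UNIV \<Longrightarrow> act x (m + n) = act x m + act x n"
  and act_mult: "x \<in> twalg UNIV \<Longrightarrow> y \<in> twalg UNIV \<Longrightarrow> act (tw_mult lam x y) m = act x (act y m)"
  and act_one [simp]: "act (tw_one lam) m = m"
  using tw_module by (auto simp: tw_module_def)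

lemma act_zero_right: "x \<in> twalg UNIV \<Longrightarrow> act x 0 = 0"
  using act_add_right[of x 0 0] by simp

lemma act_zero_left [simp]: "act (\<lambda>_. 0) m = 0"
  using act_add_left[of "\<lambda>_. 0" "\<lambda>_. 0" m] by (simp add: plus_fun_def)

lemma act_scale: "x \<in> twalg UNIV \<Longrightarrow> act (\<lambda>b. c * x b) m = scl c (act x m)"
  by (simp add: scal_def act_mult[symmetric] tw_scalar_mult)

sublocale V: vector_space scl
proof
  fix a b :: 'k and m n :: 'm
  show "scl a (m + n) = scl a m + scl a n" by (simp add: scal_def act_add_right)
  have "tw_scalar lam (a + b) = tw_scalar lam a + tw_scalar lam b"
    by (auto simp: tw_scalar_def fun_eq_iff add_divide_distrib)
  then show "scl (a + b) m = scl a m + scl b m" by (simp add: scal_def act_add_left)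
  have "tw_scalar lam (a * b) = (\<lambda>c. a * tw_scalar lam b c)" by (auto simp: tw_scalar_def)
  then have "scl (a * b) m = act (\<lambda>c. a * tw_scalar lam b c) m" by (simp add: scal_def)
  also have "\<dots> = scl a (act (tw_scalar lam b) m)" by (rule act_scale) simp
  finally show "scl a (scl b m) = scl (a * b) m" by (simp add: scal_def)
  show "scl 1 m = m" using act_one by (simp add: scal_def tw_one_def)
qed

lemma U_add: "U a (m + n) = U a m + U a n"
  by (simp add: U_def act_add_right)

lemma U_0_right [simp]: "U a 0 = 0"
  by (simp add: U_def act_zero_right)

lemma U_scl: "U a (scl c m) = scl c (U a m)"
proof -
  have "U a (scl c m) = act (\<lambda>b. c * bas a b) m"
    by (simp add: U_def scal_def act_mult[symmetric] bas_mult_scalar)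
  then show ?thesis by (simp add: U_def act_scale)
qed

lemma U_U: "U a (U b m) = scl (lam a b) (U (a + b) m)"
  by (simp add: U_def act_mult[symmetric] bas_mult_bas act_scale)

lemma U_0_left: "U 0 m = scl (lam 0 0) m"
proof -
  have "bas 0 = tw_scalar lam (lam 0 0)" by (auto simp: bas_def tw_scalar_def fun_eq_iff)
  then show ?thesis by (simp add: U_def scal_def)
qed

text \<open>The upper growth bound rests on this: elements of A move past elements of C at the cost
  of a nonzero scalar.\<close>

lemma U_comm: "U a (U b m) = scl (chi a b) (U b (U a m))"
  by (simp add: U_U chi_def add.commute)

lemma U_uminus_inv: "U a (U (- a) m) = scl (lam a (- a) * lam 0 0) m"
  by (simp add: U_U U_0_left)

lemma U_act: "x \<in> twalg UNIV \<Longrightarrow> U a (act x m) = act (conj a x) (U a m)"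
  by (simp add: U_def act_mult[symmetric] bas_mult_conj twalg_conj)

lemma act_eq:
  assumes "finite D" "fsupp x \<subseteq> D"
  shows "act x m = (\<Sum>a\<in>D. scl (x a) (U a m))"
  using assms
proof (induction D arbitrary: x rule: finite_induct)
  case empty
  then have "x = (\<lambda>_. 0)" by (auto simp: fsupp_def)
  then show ?case by simp
next
  case (insert a D)
  have f: "x(a := 0) \<in> twalg UNIV" "(\<lambda>b. x a * bas a b) \<in> twalg UNIV"
    by (rule twalgI_finite[of D]) (use insert in \<open>auto simp: fsupp_def\<close>, rule twalg_pointwise, simp)
  have "x = x(a := 0) + (\<lambda>b. x a * bas a b)" by (auto simp: fun_eq_iff bas_def)
  then have "act x m = act (x(a := 0)) m + act (\<lambda>b. x a * bas a b) m" using act_add_left[OF f] by metis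
  also have "act (\<lambda>b. x a * bas a b) m = scl (x a) (U a m)" by (simp add: act_scale U_def)
  also have "act (x(a := 0)) m = (\<Sum>c\<in>D. scl ((x(a := 0)) c) (U c m))"
    by (rule insert.IH) (use insert.prems in \<open>auto simp: fsupp_def\<close>)
  also have "\<dots> = (\<Sum>c\<in>D. scl (x c) (U c m))" using insert.hyps by (intro sum.cong) auto
  finally show ?case using insert.hyps by (simp add: add.commute)
qed

lemma act_sum: "x \<in> twalg UNIV \<Longrightarrow> act x (\<Sum>i\<in>I. f i) = (\<Sum>i\<in>I. act x (f i))"
  by (induction I rule: infinite_finite_induct) (auto simp: act_add_right act_zero_right)

lemma act_diff_left: "x \<in> twalg UNIV \<Longrightarrow> y \<in> twalg UNIV \<Longrightarrow> act (x - y) m = act x m - act y m"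
  using act_add_left[of "x - y" y m] twalg_diff[of x UNIV y] by simp

lemma act_scl: "x \<in> twalg UNIV \<Longrightarrow> act x (scl c m) = scl c (act x m)"
  using act_eq[of "fsupp x" x] by (simp add: twalg_def U_scl V.scale_sum_right mult.commute)

text \<open>\<open>0 \<in> B\<close> puts the scalars into F*B, and the basis elements span F*B over
  F. Being a submodule thus splits into linear algebra and stability under the operators
  \<open>U b\<close>.\<close>

lemma submod_iff:
  assumes "0 \<in> B"
  shows "submod act (twalg B) N \<longleftrightarrow> V.subspace N \<and> (\<forall>b\<in>B. \<forall>n\<in>N. U b n \<in> N)"
proof
  assume s: "submod act (twalg B) N"
  then show "V.subspace N \<and> (\<forall>b\<in>B. \<forall>n\<in>N. U b n \<in> N)"
    using assms by (auto simp: submod_def V.subspace_def scal_def U_def tw_scalar_in twalg_bas)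
next
  assume s: "V.subspace N \<and> (\<forall>b\<in>B. \<forall>n\<in>N. U b n \<in> N)"
  have "act x n \<in> N" if x: "x \<in> twalg B" and n: "n \<in> N" for x n
  proof -
    have "act x n = (\<Sum>a\<in>fsupp x. scl (x a) (U a n))" using x by (intro act_eq) (auto simp: twalg_def)
    also have "\<dots> \<in> N" using s x n by (intro V.subspace_sum V.subspace_scale) (auto simp: twalg_def)
    finally show ?thesis .
  qed
  then show "submod act (twalg B) N"
    using s by (auto simp: submod_def V.subspace_0 V.subspace_add V.subspace_neg)
qed

definition gens :: "'a set \<Rightarrow> 'm set \<Rightarrow> 'm set" where
  "gens B G = (\<lambda>(b, g). U b g) ` (B \<times> G)"

text \<open>\<open>B\<close> may be any set. For a subgroup this is the F*B-submodule generated by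
  \<open>G\<close>; for finite \<open>B\<close> and \<open>G\<close> it is a finite-dimensional
  piece of it, as counting requires.\<close>

definition bspan :: "'a set \<Rightarrow> 'm set \<Rightarrow> 'm set" where
  "bspan B G = V.span (gens B G)"

lemma bspan_mono: "B \<subseteq> B' \<Longrightarrow> G \<subseteq> G' \<Longrightarrow> bspan B G \<subseteq> bspan B' G'"
  unfolding bspan_def gens_def by (intro V.span_mono image_mono) auto

lemma subspace_bspan [simp]: "V.subspace (bspan B G)"
  by (simp add: bspan_def)

lemma bspan_U: "b \<in> B \<Longrightarrow> g \<in> G \<Longrightarrow> U b g \<in> bspan B G"
  unfolding bspan_def gens_def by (rule V.span_base) force

lemma bspan_base: "0 \<in> B \<Longrightarrow> g \<in> G \<Longrightarrow> g \<in> bspan B G"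
proof -
  assume "0 \<in> B" "g \<in> G"
  then have "scl (inverse (lam 0 0)) (U 0 g) \<in> bspan B G"
    by (intro V.subspace_scale) (auto intro: bspan_U)
  then show ?thesis by (simp add: U_0_left)
qed

lemma bspan_induct:
  assumes "m \<in> bspan B G" "V.subspace N" "\<And>b g. b \<in> B \<Longrightarrow> g \<in> G \<Longrightarrow> U b g \<in> N"
  shows "m \<in> N"
  using assms(1) unfolding bspan_def
  by (rule V.span_induct) (use assms in \<open>auto simp: gens_def\<close>)

lemma subspace_U_vimage: "V.subspace N \<Longrightarrow> V.subspace {m. U a m \<in> N}"
  by (auto simp: V.subspace_def U_add U_scl)

lemma U_bspan:
  assumes m: "m \<in> bspan B G" and D: "\<And>b. b \<in> B \<Longrightarrow> a + b \<in> D"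
  shows "U a m \<in> bspan D G"
proof -
  have "m \<in> {m. U a m \<in> bspan D G}"
    by (rule bspan_induct[OF m])
       (auto simp: U_U intro!: subspace_U_vimage V.subspace_scale bspan_U D)
  then show ?thesis by simp
qed

lemma submod_bspan: "is_subgroup B \<Longrightarrow> submod act (twalg B) (bspan B G)"
  by (auto simp: submod_iff is_subgroup_zero intro!: U_bspan is_subgroup_add)

lemma bspan_least: "0 \<in> B \<Longrightarrow> submod act (twalg B) N \<Longrightarrow> G \<subseteq> N \<Longrightarrow> bspan B G \<subseteq> N"
  by (auto simp: submod_iff intro: bspan_induct)

lemma gen_submod_eq: "is_subgroup B \<Longrightarrow> gen_submod act (twalg B) G = bspan B G"
  unfolding gen_submod_def
  using submod_bspan[of B G] bspan_least[of B _ G] bspan_base[of B _ G]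
  by (auto simp: is_subgroup_zero)

lemma bspan_finite:
  assumes "m \<in> bspan B G"
  shows "\<exists>Q. finite Q \<and> Q \<subseteq> B \<and> m \<in> bspan Q G"
proof -
  have "m \<in> {m. \<exists>Q. finite Q \<and> Q \<subseteq> B \<and> m \<in> bspan Q G}"
  proof (rule bspan_induct[OF assms])
    show "V.subspace {m. \<exists>Q. finite Q \<and> Q \<subseteq> B \<and> m \<in> bspan Q G}"
      unfolding V.subspace_def mem_Collect_eq
    proof (intro conjI ballI allI)
      show "\<exists>Q. finite Q \<and> Q \<subseteq> B \<and> 0 \<in> bspan Q G"
        by (rule exI[of _ "{}"]) (simp add: V.subspace_0)
    next
      fix x y assume "x \<in> {m. \<exists>Q. finite Q \<and> Q \<subseteq> B \<and> m \<in> bspan Q G}"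
        "y \<in> {m. \<exists>Q. finite Q \<and> Q \<subseteq> B \<and> m \<in> bspan Q G}"
      then obtain P Q where P: "finite P" "P \<subseteq> B" "x \<in> bspan P G" and Q: "finite Q" "Q \<subseteq> B" "y \<in> bspan Q G"
        by auto
      have "x \<in> bspan (P \<union> Q) G" "y \<in> bspan (P \<union> Q) G"
        using P Q bspan_mono[of P "P \<union> Q" G G] bspan_mono[of Q "P \<union> Q" G G] by auto
      then show "\<exists>Q. finite Q \<and> Q \<subseteq> B \<and> x + y \<in> bspan Q G"
        using P Q by (intro exI[of _ "P \<union> Q"]) (simp add: V.subspace_add)
    next
      fix c x assume "x \<in> {m. \<exists>Q. finite Q \<and> Q \<subseteq> B \<and> m \<in> bspan Q G}"
      then show "\<exists>Q. finite Q \<and> Q \<subseteq> B \<and> scl c x \<in> bspan Q G"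
        by (auto intro!: V.subspace_scale)
    qed
  next
    fix b g assume "b \<in> B" "g \<in> G"
    then show "U b g \<in> {m. \<exists>Q. finite Q \<and> Q \<subseteq> B \<and> m \<in> bspan Q G}"
      by (intro CollectI exI[of _ "{b}"]) (auto intro: bspan_U)
  qed
  then show ?thesis by simp
qed

lemma bspan_finite_set:
  assumes W: "finite W" "W \<subseteq> bspan B G" and "0 \<in> B"
  obtains Q where "finite Q" "0 \<in> Q" "Q \<subseteq> B" "W \<subseteq> bspan Q G"
proof -
  have "\<forall>w\<in>W. \<exists>Q. finite Q \<and> Q \<subseteq> B \<and> w \<in> bspan Q G"
    using W bspan_finite by blast
  then obtain q where q: "\<And>w. w \<in> W \<Longrightarrow> finite (q w) \<and> q w \<subseteq> B \<and> w \<in> bspan (q w) G" by metis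
  show thesis
  proof (rule that[of "insert 0 (\<Union>w\<in>W. q w)"])
    show "W \<subseteq> bspan (insert 0 (\<Union>w\<in>W. q w)) G"
    proof
      fix w assume w: "w \<in> W"
      then have "w \<in> bspan (q w) G" using q by blast
      moreover have "bspan (q w) G \<subseteq> bspan (insert 0 (\<Union>w\<in>W. q w)) G"
        using w by (intro bspan_mono) auto
      ultimately show "w \<in> bspan (insert 0 (\<Union>w\<in>W. q w)) G" by blast
    qed
  qed (use W q assms in auto)
qed

lemma finite_gens: "finite Q \<Longrightarrow> finite G \<Longrightarrow> finite (gens Q G)"
  and card_gens_le: "finite Q \<Longrightarrow> finite G \<Longrightarrow> card (gens Q G) \<le> card Q * card G"
  unfolding gens_def card_cartesian_product[symmetric] by (simp, rule card_image_le, rule finite_cartesian_product)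

text \<open>A repeated vector is exposed by the coefficients 1 and -1 at its two indices.\<close>

lemma indep_family_inj:
  assumes I: "finite I" and ind: "\<And>c. (\<Sum>i\<in>I. scl (c i) (f i)) = 0 \<Longrightarrow> \<forall>i\<in>I. c i = 0"
  shows "inj_on f I"
proof (rule inj_onI, rule ccontr)
  fix i j assume ij: "i \<in> I" "j \<in> I" "f i = f j" "i \<noteq> j"
  define c :: "'b \<Rightarrow> 'k" where "c = (\<lambda>k. if k = i then 1 else if k = j then - 1 else 0)"
  have "(\<Sum>k\<in>I. scl (c k) (f k)) = (\<Sum>k\<in>I. (if k = i then f k else 0) + (if k = j then - f k else 0))"
    by (intro sum.cong refl) (use ij in \<open>auto simp: c_def\<close>)
  also have "\<dots> = 0" using I ij by (simp add: sum.distrib)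
  finally have "c i = 0" using ind ij by blast
  then show False by (simp add: c_def)
qed

lemma indep_family_independent:
  assumes I: "finite I" and ind: "\<And>c. (\<Sum>i\<in>I. scl (c i) (f i)) = 0 \<Longrightarrow> \<forall>i\<in>I. c i = 0"
  shows "V.independent (f ` I)"
proof (rule V.independent_if_scalars_zero)
  fix c x assume s: "(\<Sum>x\<in>f ` I. scl (c x) x) = 0" and x: "x \<in> f ` I"
  have "(\<Sum>i\<in>I. scl (c (f i)) (f i)) = 0"
    using s by (simp add: sum.reindex[OF indep_family_inj[OF assms]])
  then show "c x = 0" using ind[of "\<lambda>i. c (f i)"] x by auto
qed (use I in simp)

lemma indep_family_card_le:
  assumes I: "finite I" and ind: "\<And>c. (\<Sum>i\<in>I. scl (c i) (f i)) = 0 \<Longrightarrow> \<forall>i\<in>I. c i = 0"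
    and T: "finite T" "f ` I \<subseteq> V.span T"
  shows "card I \<le> card T"
  using V.independent_span_bound[OF T(1) indep_family_independent[OF I ind] T(2)]
    card_image[OF indep_family_inj[OF I ind]] by simp

text \<open>Families are used in place of sets because those that occur, such as the translates of
  one element, are not known to be injective in advance.\<close>

definition bindep :: "'a set \<Rightarrow> 'i set \<Rightarrow> ('i \<Rightarrow> 'm) \<Rightarrow> bool" where
  "bindep B I w \<longleftrightarrow> (\<forall>r. (\<forall>i\<in>I. r i \<in> twalg B) \<longrightarrow> (\<Sum>i\<in>I. act (r i) (w i)) = 0 \<longrightarrow>
     (\<forall>i\<in>I. r i = (\<lambda>_. 0)))"

text \<open>For fixed \<open>i\<close> the scalars \<open>c (b, i)\<close> are the coefficients of
  one element of F*B, so a relation over F among translates is a relation over F*B.\<close>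

lemma bindep_imp_indep_family:
  assumes ind: "bindep B I w" and I: "finite I" and D: "finite D" "D \<subseteq> B"
    and s: "(\<Sum>p\<in>D \<times> I. scl (c p) (U (fst p) (w (snd p)))) = 0"
  shows "\<forall>p\<in>D \<times> I. c p = 0"
proof -
  define r where "r i = (\<lambda>b. if b \<in> D then c (b, i) else 0)" for i
  have fs: "fsupp (r i) \<subseteq> D" for i by (auto simp: r_def fsupp_def)
  have rB: "r i \<in> twalg B" for i
    by (rule twalgI_finite[OF D]) (simp add: r_def)
  have "(\<Sum>i\<in>I. act (r i) (w i)) = (\<Sum>i\<in>I. \<Sum>b\<in>D. scl (c (b, i)) (U b (w i)))"
    by (intro sum.cong refl) (simp add: act_eq[OF D(1) fs], simp add: r_def)
  also have "\<dots> = (\<Sum>p\<in>D \<times> I. scl (c p) (U (fst p) (w (snd p))))"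
    by (subst sum.swap) (simp add: sum.cartesian_product case_prod_beta)
  finally have "r i = (\<lambda>_. 0)" if "i \<in> I" for i
    using ind s rB that unfolding bindep_def by metis
  then show ?thesis by (auto simp: r_def fun_eq_iff) (metis)
qed

text \<open>Counting dimensions over the base field replaces the field of fractions: for \<open>D\<close> a large
  iterated sumset, the translates by \<open>D\<close> of the independent family lie in the span of the translates
  of \<open>G\<close> by the only slightly larger set \<open>D + Q\<close>.\<close>

lemma bindep_card_le:
  assumes slow: "slow_growth B" and B: "is_subgroup B"
    and I: "finite I" and G: "finite G" and ind: "bindep B I w" and w: "w ` I \<subseteq> bspan B G"
  shows "card I \<le> card G"
proof -
  obtain Q where Q: "finite Q" "0 \<in> Q" "Q \<subseteq> B" "w ` I \<subseteq> bspan Q G"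
    using bspan_finite_set[of "w ` I" B G] I w is_subgroup_zero[OF B] by blast
  \<comment> \<open>Taking \<open>card G\<close> for \<open>s\<close> yields |I| |D| \<le> |G| |E| <
    (|G| + 1) |D| at the end, with D and E the sumsets for \<open>k\<close> and
    \<open>k + 1\<close>.\<close>
  obtain k where k: "card G * card (nsum Q (Suc k)) < Suc (card G) * card (nsum Q k)"
    using slow Q unfolding slow_growth_def by blast
  let ?D = "nsum Q k" and ?E = "nsum Q (Suc k)"
  have D: "finite ?D" "?D \<subseteq> B" using Q B by (auto intro: finite_nsum nsum_subset[THEN subsetD])
  have E: "finite ?E" using Q by (intro finite_nsum)
  have "card (?D \<times> I) \<le> card (gens ?E G)"
  proof (rule indep_family_card_le)
    show "finite (?D \<times> I)" using D I by simp
    show "\<forall>p\<in>?D \<times> I. c p = 0" if "(\<Sum>p\<in>?D \<times> I. scl (c p) (U (fst p) (w (snd p)))) = 0" for c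
      by (rule bindep_imp_indep_family[OF ind I D that])
    show "finite (gens ?E G)" by (rule finite_gens[OF E G])
    have "U b (w i) \<in> bspan ?E G" if "b \<in> ?D" "i \<in> I" for b i
      by (rule U_bspan[of _ Q]) (use that Q nsum_Suc_I[of b Q k] in auto)
    then show "(\<lambda>p. U (fst p) (w (snd p))) ` (?D \<times> I) \<subseteq> V.span (gens ?E G)"
      by (auto simp: bspan_def)
  qed
  also have "\<dots> \<le> card ?E * card G" by (rule card_gens_le[OF E G])
  finally have "card ?D * card I \<le> card G * card ?E" by (simp add: card_cartesian_product mult.commute)
  then have "card ?D * card I < card ?D * Suc (card G)" using k by (simp add: mult.commute)
  then show ?thesis unfolding mult_less_cancel1 by simp
qed

end

section \<open>Growth in lattices\<close>

lemma zindep_subset: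
  assumes "zindep S" "S' \<subseteq> S" "finite S"
  shows "zindep S'"
  unfolding zindep_def
proof (intro allI impI)
  fix u assume u: "(\<Sum>s\<in>S'. u s *s s) = 0"
  have "(\<Sum>s\<in>S. (if s \<in> S' then u s else 0) *s s) = (\<Sum>s\<in>S'. u s *s s)"
    using assms by (intro sum.mono_neutral_cong_right) auto
  then have "\<forall>s\<in>S. (if s \<in> S' then u s else 0) = 0"
    using assms(1)[unfolded zindep_def, THEN spec, of "\<lambda>s. if s \<in> S' then u s else 0"] u by simp
  then show "\<forall>s\<in>S'. u s = 0" using assms(2) by (auto split: if_splits)
qed

text \<open>The difference of two coefficient functions with the same sum is a relation. The
  extensional function space makes the functions agree outside \<open>S\<close> too.\<close>

lemma zindep_inj_on:
  fixes A :: "int set"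
  assumes "zindep S" "finite S"
  shows "inj_on (\<lambda>f. \<Sum>s\<in>S. f s *s s) (S \<rightarrow>\<^sub>E A)"
proof (rule inj_onI)
  fix f g assume f: "f \<in> S \<rightarrow>\<^sub>E A" and g: "g \<in> S \<rightarrow>\<^sub>E A"
    and eq: "(\<Sum>s\<in>S. f s *s s) = (\<Sum>s\<in>S. g s *s s)"
  have "(\<Sum>s\<in>S. (f s - g s) *s s) = (\<Sum>s\<in>S. f s *s s) - (\<Sum>s\<in>S. g s *s s)"
    by (simp add: vec_eq_iff sum_component left_diff_distrib sum_subtractf)
  then have "(\<Sum>s\<in>S. (f s - g s) *s s) = 0" using eq by simp
  then have "\<forall>s\<in>S. f s - g s = 0"
    using assms(1)[unfolded zindep_def, THEN spec, of "\<lambda>s. f s - g s"] by simp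
  then show "f = g" using f g by (intro PiE_ext[OF f g]) auto
qed

lemma card_box_le: "card {v :: int ^ 'n. \<forall>i. \<bar>v $ i\<bar> \<le> int X} \<le> (2 * X + 1) ^ CARD('n)"
  and finite_box: "finite {v :: int ^ 'n. \<forall>i. \<bar>v $ i\<bar> \<le> int X}"
proof -
  let ?P = "(UNIV :: 'n set) \<rightarrow>\<^sub>E {- int X .. int X}"
  have sub: "{v :: int ^ 'n. \<forall>i. \<bar>v $ i\<bar> \<le> int X} \<subseteq> vec_lambda ` ?P"
  proof
    fix v :: "int ^ 'n" assume v: "v \<in> {v. \<forall>i. \<bar>v $ i\<bar> \<le> int X}"
    have "v $ i \<in> {- int X .. int X}" for i using v by (auto simp: abs_le_iff minus_le_iff)
    then have "vec_nth v \<in> ?P" by auto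
    moreover have "v = vec_lambda (vec_nth v)" by simp
    ultimately show "v \<in> vec_lambda ` ?P" by blast
  qed
  have fin: "finite ?P" by (intro finite_PiE) auto
  have "nat (int X - - int X + 1) = 2 * X + 1" by simp
  then have "card ?P = (2 * X + 1) ^ CARD('n)" by (simp add: card_PiE)
  then show "card {v :: int ^ 'n. \<forall>i. \<bar>v $ i\<bar> \<le> int X} \<le> (2 * X + 1) ^ CARD('n)"
    using surj_card_le[OF fin sub] by simp
  show "finite {v :: int ^ 'n. \<forall>i. \<bar>v $ i\<bar> \<le> int X}" using finite_subset[OF sub] fin by blast
qed

text \<open>Linear independence over \<open>\<int>\<close> is bounded by counting: the nonnegative combinations with
  coefficients at most \<open>k\<close> are distinct and lie in a box of side proportional to \<open>k\<close>.\<close>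

lemma zindep_card_le:
  fixes S :: "(int ^ 'n) set"
  assumes S: "zindep S" "finite S"
  shows "card S \<le> CARD('n)"
proof (rule ccontr)
  let ?n = "CARD('n)"
  assume "\<not> card S \<le> ?n"
  then obtain T where T: "T \<subseteq> S" "card T = Suc ?n" by (metis not_less_eq_eq obtain_subset_with_card_n)
  have fT: "finite T" using T S finite_subset by blast
  have zT: "zindep T" using zindep_subset S T by blast
  define L where "L = nat (\<Sum>s\<in>T. \<Sum>i\<in>UNIV. \<bar>s $ i\<bar>)"
  have L: "(\<Sum>s\<in>T. \<bar>s $ i\<bar>) \<le> int L" for i
  proof -
    have "(\<Sum>s\<in>T. \<bar>s $ i\<bar>) \<le> (\<Sum>s\<in>T. \<Sum>i\<in>UNIV. \<bar>s $ i\<bar>)"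
      by (intro sum_mono member_le_sum) auto
    then show ?thesis by (simp add: L_def sum_nonneg)
  qed
  have bound: "(k + 1) ^ Suc ?n \<le> (2 * (k * L) + 1) ^ ?n" for k :: nat
  proof -
    let ?P = "T \<rightarrow>\<^sub>E {0..int k}"
    have "(k + 1) ^ Suc ?n = card ?P" using fT T by (simp add: card_PiE nat_add_distrib)
    also have "\<dots> = card ((\<lambda>f. \<Sum>s\<in>T. f s *s s) ` ?P)"
      by (rule card_image[symmetric]) (rule zindep_inj_on[OF zT fT])
    also have "\<dots> \<le> card {v :: int ^ 'n. \<forall>i. \<bar>v $ i\<bar> \<le> int (k * L)}"
    proof (intro card_mono finite_box subsetI)
      fix v assume "v \<in> (\<lambda>f. \<Sum>s\<in>T. f s *s s) ` ?P"
      then obtain f where f: "f \<in> ?P" "v = (\<Sum>s\<in>T. f s *s s)" by auto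
      have "\<bar>v $ i\<bar> \<le> int (k * L)" for i
      proof -
        have "\<bar>v $ i\<bar> \<le> (\<Sum>s\<in>T. \<bar>f s * s $ i\<bar>)" by (simp add: f(2) sum_component sum_abs)
        also have "\<dots> \<le> (\<Sum>s\<in>T. int k * \<bar>s $ i\<bar>)"
          using f(1) by (intro sum_mono) (auto simp: abs_mult PiE_def Pi_def intro!: mult_right_mono)
        also have "\<dots> = int k * (\<Sum>s\<in>T. \<bar>s $ i\<bar>)" by (simp add: sum_distrib_left)
        also have "\<dots> \<le> int k * int L" using L by (intro mult_left_mono) auto
        finally show ?thesis by simp
      qed
      then show "v \<in> {v. \<forall>i. \<bar>v $ i\<bar> \<le> int (k * L)}" by simp
    qed
    also have "\<dots> \<le> (2 * (k * L) + 1) ^ ?n" by (rule card_box_le)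
    finally show ?thesis .
  qed
  \<comment> \<open>As 2kL + 1 \<le> (2L + 1)(k + 1), this choice turns the bound into (k + 1)^(n +
    1) \<le> k (k + 1)^n, which is absurd.\<close>
  define k where "k = (2 * L + 1) ^ ?n"
  have "(2 * (k * L) + 1) ^ ?n \<le> ((2 * L + 1) * (k + 1)) ^ ?n"
    by (intro power_mono) (auto simp: algebra_simps)
  then have "(k + 1) * (k + 1) ^ ?n \<le> k * (k + 1) ^ ?n"
    using bound[of k] unfolding power_mult_distrib power_Suc k_def[symmetric] by (rule order_trans[rotated])
  then show False by simp
qed

text \<open>\<open>Max\<close> is informative only on a finite nonempty set; the bound by the
  dimension and the empty family provide both properties.\<close>

lemma
  fixes C :: "(int ^ 'n) set"
  shows tf_rank_witness: "\<exists>S. finite S \<and> S \<subseteq> C \<and> zindep S \<and> card S = tf_rank C"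
    and tf_rank_ge: "finite S \<Longrightarrow> S \<subseteq> C \<Longrightarrow> zindep S \<Longrightarrow> card S \<le> tf_rank C"
proof -
  let ?X = "{card S | S. finite S \<and> S \<subseteq> C \<and> zindep S}"
  have "?X \<subseteq> {..CARD('n)}" using zindep_card_le by auto
  then have fin: "finite ?X" using finite_subset by blast
  have "zindep ({} :: (int ^ 'n) set)" by (simp add: zindep_def)
  then have ne: "?X \<noteq> {}" by blast
  show "\<exists>S. finite S \<and> S \<subseteq> C \<and> zindep S \<and> card S = tf_rank C"
    using Max_in[OF fin ne] unfolding tf_rank_def by force
  show "card S \<le> tf_rank C" if "finite S" "S \<subseteq> C" "zindep S"
    unfolding tf_rank_def using that by (intro Max_ge fin) blast
qed

text \<open>By maximality of \<open>card S\<close>, adjoining \<open>q\<close> creates a relation,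
  and independence of \<open>S\<close> forces a nonzero coefficient at \<open>q\<close>. For
  \<open>q \<in> S\<close> nothing is adjoined and the multiplier 1 serves.\<close>

lemma tf_rank_multiple:
  fixes C :: "(int ^ 'n) set"
  assumes S: "finite S" "S \<subseteq> C" "zindep S" "card S = tf_rank C" and q: "q \<in> C"
  shows "\<exists>N f. N \<noteq> (0 :: int) \<and> N *s q = (\<Sum>s\<in>S. f s *s s)"
proof (cases "q \<in> S")
  case True
  have "(\<Sum>s\<in>S. (if s = q then 1 else 0) *s s) = (\<Sum>s\<in>S. if s = q then s else 0)"
    by (intro sum.cong) auto
  also have "\<dots> = 1 *s q" using S True by simp
  finally show ?thesis by (intro exI[of _ 1] exI[of _ "\<lambda>s. if s = q then 1 else 0"]) simp
next
  case False
  have "\<not> zindep (insert q S)" using tf_rank_ge[of "insert q S" C] S q False by auto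
  then obtain u where u: "(\<Sum>s\<in>insert q S. u s *s s) = 0" "\<exists>s\<in>insert q S. u s \<noteq> 0"
    unfolding zindep_def not_all not_imp by (elim exE conjE) (rule that, auto)
  have eq: "u q *s q + (\<Sum>s\<in>S. u s *s s) = 0" using u(1) S False by simp
  have "u q \<noteq> 0"
  proof
    assume 0: "u q = 0"
    then have "(\<Sum>s\<in>S. u s *s s) = 0" using eq by simp
    then have "\<forall>s\<in>S. u s = 0" using S(3)[unfolded zindep_def, THEN spec, of u] by simp
    then show False using u(2) 0 by simp
  qed
  moreover have "u q *s q = (\<Sum>s\<in>S. (- u s) *s s)"
  proof -
    have "(\<Sum>s\<in>S. (- u s) *s s) = - (\<Sum>s\<in>S. u s *s s)"
      by (simp add: vec_eq_iff sum_component sum_negf)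
    then show ?thesis using eq by (metis eq_neg_iff_add_eq_0)
  qed
  ultimately show ?thesis by (intro exI[of _ "u q"] exI[of _ "\<lambda>s. - u s"] conjI)
qed

lemma tf_rank_common_multiple:
  fixes C :: "(int ^ 'n) set"
  assumes S: "finite S" "S \<subseteq> C" "zindep S" "card S = tf_rank C" and Q: "finite Q" "Q \<subseteq> C"
  shows "\<exists>N. N \<noteq> (0 :: int) \<and> (\<forall>q\<in>Q. \<exists>f. N *s q = (\<Sum>s\<in>S. f s *s s))"
  using Q
proof (induction Q rule: finite_induct)
  case empty
  show ?case by (rule exI[of _ 1]) simp
next
  case (insert q Q)
  then obtain N where N: "N \<noteq> 0" "\<forall>q\<in>Q. \<exists>f. N *s q = (\<Sum>s\<in>S. f s *s s)" by auto
  obtain N' f where N': "N' \<noteq> 0" "N' *s q = (\<Sum>s\<in>S. f s *s s)"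
    using tf_rank_multiple[OF S, of q] insert.prems by auto
  have mult: "(a * b) *s v = (\<Sum>s\<in>S. (a * g s) *s s)" if "b *s v = (\<Sum>s\<in>S. g s *s s)" for a b :: int and v g
  proof -
    have "(a * b) *s v = a *s (b *s v)" by (simp add: vec_eq_iff mult.assoc)
    also have "\<dots> = (\<Sum>s\<in>S. (a * g s) *s s)"
      unfolding that by (simp add: vec_eq_iff sum_component sum_distrib_left mult.assoc)
    finally show ?thesis .
  qed
  have "\<exists>f. (N' * N) *s p = (\<Sum>s\<in>S. f s *s s)" if p: "p \<in> insert q Q" for p
  proof (cases "p = q")
    case True
    then show ?thesis using mult[OF N'(2), of N] by (auto simp: mult.commute)
  next
    case False
    then obtain g where "N *s p = (\<Sum>s\<in>S. g s *s s)" using N(2) p by auto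
    then show ?thesis using mult[of N p g N'] by (intro exI[of _ "\<lambda>s. N' * g s"])
  qed
  then show ?case using N N' by (intro exI[of _ "N' * N"]) auto
qed

text \<open>Multiplication by the common multiplier \<open>N\<close> is injective and carries
  \<open>k\<close>-fold sums to combinations of \<open>S\<close> with coefficients of absolute value
  at most \<open>k * L\<close>. The number of these is polynomial in \<open>k\<close> of degree
  \<open>card S\<close>.\<close>

lemma nsum_growth:
  fixes C Q :: "(int ^ 'n) set"
  assumes Q: "finite Q" "Q \<subseteq> C"
  shows "\<exists>K. \<forall>k. card (nsum Q k) \<le> K * (k + 1) ^ tf_rank C"
proof -
  obtain S where S: "finite S" "S \<subseteq> C" "zindep S" "card S = tf_rank C" using tf_rank_witness by blast
  obtain N where N: "N \<noteq> (0::int)" "\<forall>q\<in>Q. \<exists>f. N *s q = (\<Sum>s\<in>S. f s *s s)"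
    using tf_rank_common_multiple[OF S Q] by blast
  obtain F where F: "\<And>q. q \<in> Q \<Longrightarrow> N *s q = (\<Sum>s\<in>S. F q s *s s)"
    using bchoice[OF N(2)] by (elim exE) (rule that, simp)
  define L where "L = nat (\<Sum>q\<in>Q. \<Sum>s\<in>S. \<bar>F q s\<bar>)"
  have L: "\<bar>F q s\<bar> \<le> int L" if "q \<in> Q" "s \<in> S" for q s
  proof -
    have "\<bar>F q s\<bar> \<le> (\<Sum>s\<in>S. \<bar>F q s\<bar>)" using S that by (intro member_le_sum) auto
    also have "\<dots> \<le> (\<Sum>q\<in>Q. \<Sum>s\<in>S. \<bar>F q s\<bar>)"
      using Q that by (intro member_le_sum[of q Q "\<lambda>q. \<Sum>s\<in>S. \<bar>F q s\<bar>"]) (auto intro: sum_nonneg)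
    finally show ?thesis by (simp add: L_def sum_nonneg)
  qed
  have rep: "\<exists>f. N *s v = (\<Sum>s\<in>S. f s *s s) \<and> (\<forall>s\<in>S. \<bar>f s\<bar> \<le> int (k * L))" if "v \<in> nsum Q k" for v k
    using that
  proof (induction k arbitrary: v)
    case 0
    then show ?case by (intro exI[of _ "\<lambda>_. 0"]) (simp add: vec_eq_iff)
  next
    case (Suc k)
    then obtain w q where v: "v = w + q" "w \<in> nsum Q k" "q \<in> Q" by auto
    obtain f where f: "N *s w = (\<Sum>s\<in>S. f s *s s)" "\<forall>s\<in>S. \<bar>f s\<bar> \<le> int (k * L)"
      using Suc.IH[OF v(2)] by (elim exE conjE) (rule that)
    have "N *s v = N *s w + N *s q" by (simp add: v vec_eq_iff distrib_left)
    also have "\<dots> = (\<Sum>s\<in>S. (f s + F q s) *s s)"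
      unfolding f(1) F[OF v(3)] by (simp add: vec_eq_iff sum_component sum.distrib distrib_right)
    finally have "N *s v = (\<Sum>s\<in>S. (f s + F q s) *s s)" .
    moreover have "\<bar>f s + F q s\<bar> \<le> int (Suc k * L)" if "s \<in> S" for s
    proof -
      have "\<bar>f s\<bar> \<le> int (k * L)" using f(2) that by blast
      moreover have "int (Suc k * L) = int L + int (k * L)" by simp
      ultimately show ?thesis using L[OF v(3) that] abs_triangle_ineq[of "f s" "F q s"] by linarith
    qed
    ultimately show ?case by (intro exI[of _ "\<lambda>s. f s + F q s"]) auto
  qed
  have "card (nsum Q k) \<le> (2 * L + 1) ^ tf_rank C * (k + 1) ^ tf_rank C" for k
  proof -
    let ?P = "S \<rightarrow>\<^sub>E {- int (k * L) .. int (k * L)}"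
    have fP: "finite ?P" using S by (intro finite_PiE) auto
    have inj: "inj_on (\<lambda>v. N *s v) (nsum Q k)" using N(1) by (auto simp: inj_on_def vec_eq_iff)
    have "card (nsum Q k) = card ((\<lambda>v. N *s v) ` nsum Q k)" by (rule card_image[OF inj, symmetric])
    also have "\<dots> \<le> card ?P"
    proof (rule surj_card_le[OF fP, where f = "\<lambda>f. \<Sum>s\<in>S. f s *s s"], rule subsetI)
      fix w assume "w \<in> (\<lambda>v. N *s v) ` nsum Q k"
      then obtain v where v: "v \<in> nsum Q k" "w = N *s v" by auto
      obtain f where f: "w = (\<Sum>s\<in>S. f s *s s)" "\<forall>s\<in>S. \<bar>f s\<bar> \<le> int (k * L)"
        using rep[OF v(1)] v(2) by (elim exE conjE) (rule that, auto)
      have "restrict f S \<in> ?P" using f(2) by (auto simp: abs_le_iff minus_le_iff simp del: of_nat_mult)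
      moreover have "w = (\<Sum>s\<in>S. restrict f S s *s s)" unfolding f(1) by (intro sum.cong) auto
      ultimately show "w \<in> (\<lambda>f. \<Sum>s\<in>S. f s *s s) ` ?P" by (intro image_eqI)
    qed
    also have "\<dots> = (2 * (k * L) + 1) ^ tf_rank C"
    proof -
      have "nat (int (k * L) - - int (k * L) + 1) = 2 * (k * L) + 1" by (simp del: of_nat_mult)
      then show ?thesis using S by (simp add: card_PiE)
    qed
    also have "\<dots> \<le> ((2 * L + 1) * (k + 1)) ^ tf_rank C"
      by (intro power_mono) (auto simp: algebra_simps)
    finally show ?thesis unfolding power_mult_distrib .
  qed
  then show ?thesis by blast
qed

text \<open>If the condition failed for some \<open>s\<close>, the sizes would grow at least like (1
  + 1/s)^k, against the polynomial bound.\<close>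

lemma slow_growth_int_vec: "slow_growth (B :: (int ^ 'n) set)"
  unfolding slow_growth_def
proof (intro allI impI, rule ccontr)
  fix Q :: "(int ^ 'n) set" and s :: nat
  assume Q: "finite Q" "Q \<noteq> {}" "Q \<subseteq> B"
    and "\<nexists>k. s * card (nsum Q (Suc k)) < Suc s * card (nsum Q k)"
  then have ge: "Suc s * card (nsum Q k) \<le> s * card (nsum Q (Suc k))" for k by (meson not_less)
  \<comment> \<open>For \<open>s = 0\<close> the inequality at \<open>k = 0\<close> would read 1
    \<le> 0, since \<open>nsum Q 0\<close> has one element.\<close>
  have s: "s > 0" using ge[of 0] by (cases s) auto
  have pow: "Suc s ^ k \<le> s ^ k * card (nsum Q k)" for k
  proof (induction k)
    case (Suc k)
    have "Suc s ^ Suc k \<le> Suc s * (s ^ k * card (nsum Q k))" unfolding power_Suc using Suc by (intro mult_left_mono) auto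
    also have "\<dots> = s ^ k * (Suc s * card (nsum Q k))" by (simp only: ac_simps)
    also have "\<dots> \<le> s ^ k * (s * card (nsum Q (Suc k)))" by (intro mult_left_mono ge) auto
    finally show ?case by (simp add: ac_simps)
  qed simp
  obtain K where K: "\<And>k. card (nsum Q k) \<le> K * (k + 1) ^ tf_rank B" using nsum_growth[OF Q(1,3)] by blast
  define d c where "d = tf_rank B" and "c = 1 + 1 / real s"
  have c: "c > 1" using s by (simp add: c_def)
  have bound: "c ^ k \<le> real K * (real k + 1) ^ d" for k
  proof -
    have "Suc s ^ k \<le> s ^ k * (K * (k + 1) ^ d)"
      using pow[of k] K[of k] unfolding d_def by (meson le_trans mult_le_mono2)
    then have "real (Suc s ^ k) \<le> real (s ^ k * (K * (k + 1) ^ d))" by (rule of_nat_mono)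
    then have "(real s + 1) ^ k \<le> real s ^ k * (real K * (real k + 1) ^ d)" by (simp add: add.commute)
    moreover have "c ^ k = (real s + 1) ^ k / real s ^ k"
    proof -
      have "c = (real s + 1) / real s" using s by (simp add: c_def field_simps)
      then show ?thesis by (simp add: power_divide)
    qed
    ultimately show ?thesis using s by (simp add: divide_le_eq mult.commute)
  qed
  have "((\<lambda>k. real K * (real k + 1) ^ d / c ^ k) \<longlongrightarrow> 0) sequentially"
    using c by real_asymp
  then have "eventually (\<lambda>k. real K * (real k + 1) ^ d / c ^ k < 1) sequentially"
    by (rule order_tendstoD) simp
  then obtain k where "real K * (real k + 1) ^ d / c ^ k < 1" by (auto simp: eventually_sequentially)
  then show False using bound[of k] c by (simp add: field_simps)
qed

section \<open>From polynomial bounds to logarithmic growth rates\<close>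

lemma limsup_growth_le:
  assumes K: "\<And>k. d k \<le> K * (k + 1) ^ r"
  shows "limsup (\<lambda>k. ereal (ln (real (d k)) / ln (real k))) \<le> ereal (real r)"
proof -
  \<comment> \<open>The summand 1 keeps \<open>ln K'\<close> nonnegative, also for
    \<open>K = 0\<close>.\<close>
  define K' where "K' = real K + 1"
  have K': "K' \<ge> 1" by (simp add: K'_def)
  have "limsup (\<lambda>k. ereal (ln (real (d k)) / ln (real k)))
      \<le> limsup (\<lambda>k. ereal ((ln K' + real r * ln (real k + 1)) / ln (real k)))"
  proof (rule Limsup_mono, rule eventually_mono[OF eventually_gt_at_top[of 1]])
    fix k :: nat assume k: "k > 1"
    have "ln (real (d k)) \<le> ln K' + real r * ln (real k + 1)"
    proof (cases "d k = 0")
      \<comment> \<open>In HOL \<open>ln 0 = 0\<close>, so a vanishing value of \<open>d\<close> is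
        covered once the right-hand side is nonnegative.\<close>
      case True
      have "0 \<le> ln K' + real r * ln (real k + 1)" using K' by (intro add_nonneg_nonneg mult_nonneg_nonneg) auto
      then show ?thesis using True by simp
    next
      case False
      have "real (d k) \<le> real (K * (k + 1) ^ r)" by (rule of_nat_mono[OF K])
      also have "\<dots> \<le> K' * (real k + 1) ^ r" by (simp add: K'_def add.commute mult_right_mono)
      finally have "ln (real (d k)) \<le> ln (K' * (real k + 1) ^ r)" using False by (intro ln_mono) auto
      also have "\<dots> = ln K' + real r * ln (real k + 1)" using K' by (subst ln_mult) (auto simp: ln_realpow)
      finally show ?thesis .
    qed
    then show "ereal (ln (real (d k)) / ln (real k)) \<le> ereal ((ln K' + real r * ln (real k + 1)) / ln (real k))"
      using k by (simp add: divide_right_mono)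
  qed
  also have "((\<lambda>k. (ln K' + real r * ln (real k + 1)) / ln (real k)) \<longlongrightarrow> real r) sequentially"
    by real_asymp
  then have "limsup (\<lambda>k. ereal ((ln K' + real r * ln (real k + 1)) / ln (real k))) = ereal (real r)"
    by (intro lim_imp_Limsup) auto
  finally show ?thesis .
qed

text \<open>Rounding \<open>k / e\<close> down costs at most 1, which does not change the ratio of
  logarithms in the limit.\<close>

lemma limsup_growth_ge:
  assumes e: "e > 0" and d: "\<And>k. (k div e) ^ r \<le> d k"
  shows "ereal (real r) \<le> limsup (\<lambda>k. ereal (ln (real (d k)) / ln (real k)))"
proof -
  have e': "real e > 0" using e by simp
  have "((\<lambda>k. (real r * ln (real k / real e - 1)) / ln (real k)) \<longlongrightarrow> real r) sequentially"
    using e' by real_asymp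
  then have "ereal (real r) = limsup (\<lambda>k. ereal ((real r * ln (real k / real e - 1)) / ln (real k)))"
    by (intro lim_imp_Limsup[symmetric]) auto
  also have "\<dots> \<le> limsup (\<lambda>k. ereal (ln (real (d k)) / ln (real k)))"
  proof (rule Limsup_mono, rule eventually_mono[OF eventually_gt_at_top[of "2 * e"]])
    fix k :: nat assume k: "k > 2 * e"
    have pos: "real k / real e - 1 > 0" using k e by (simp add: field_simps)
    have "real k / real e - 1 \<le> real (k div e)"
    proof -
      have "k = e * (k div e) + k mod e" by simp
      then have "real k = real e * real (k div e) + real (k mod e)" by (metis of_nat_add of_nat_mult)
      moreover have "real (k mod e) \<le> real e" using e by (simp add: less_imp_le)
      ultimately show ?thesis using e by (simp add: field_simps)
    qed
    then have "(real k / real e - 1) ^ r \<le> real ((k div e) ^ r)"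
      using pos by (simp add: power_mono)
    also have "\<dots> \<le> real (d k)" by (rule of_nat_mono[OF d])
    finally have "ln ((real k / real e - 1) ^ r) \<le> ln (real (d k))"
      using pos by (intro ln_mono) auto
    then have "real r * ln (real k / real e - 1) \<le> ln (real (d k))" using pos by (simp add: ln_realpow)
    then show "ereal ((real r * ln (real k / real e - 1)) / ln (real k)) \<le> ereal (ln (real (d k)) / ln (real k))"
      using k e by (simp add: divide_right_mono)
  qed
  finally show ?thesis .
qed

section \<open>Torsion and rank\<close>

lemma sum_fun_eval: "(\<Sum>i\<in>I. f i) p = (\<Sum>i\<in>I. f i p :: 'k::comm_monoid_add)"
  by (induction I rule: infinite_finite_induct) auto

context cocycle
begin

text \<open>Basis elements of pairwise incongruent \<open>t\<close> are free over F*B: the summands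
  have supports in disjoint cosets of \<open>B\<close>, so the value at \<open>b + t\<close>
  isolates the coefficient \<open>r t b\<close>.\<close>

lemma transversal_sum_eq_0:
  assumes T: "finite T" "\<And>s t. s \<in> T \<Longrightarrow> t \<in> T \<Longrightarrow> s - t \<in> B \<Longrightarrow> s = t"
    and B: "is_subgroup B" and r: "\<And>t. t \<in> T \<Longrightarrow> r t \<in> twalg B"
    and s: "(\<Sum>t\<in>T. tw_mult lam (r t) (bas t)) = (\<lambda>_. 0)" and t: "t \<in> T"
  shows "r t = (\<lambda>_. 0)"
proof
  fix b
  show "r t b = 0"
  proof (cases "b \<in> B")
    case True
    have "0 = (\<Sum>u\<in>T. tw_mult lam (r u) (bas u)) (b + t)" using s by simp
    also have "\<dots> = (\<Sum>u\<in>T. r u (b + t - u) * lam (b + t - u) u)"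
      unfolding sum_fun_eval by (intro sum.cong refl) (simp add: mult_bas[OF twalg_UNIV_I[OF r]])
    also have "\<dots> = (\<Sum>u\<in>T. if u = t then r t b * lam b t else 0)"
    proof (rule sum.cong[OF refl])
      fix u assume u: "u \<in> T"
      have "r u (b + t - u) = 0" if "u \<noteq> t"
      proof (rule twalg_outside[OF r[OF u]])
        show "b + t - u \<notin> B"
        proof
          assume "b + t - u \<in> B"
          then have "(b + t - u) - b \<in> B" using True by (rule is_subgroup_diff[OF B])
          then have "t - u \<in> B" by (simp add: algebra_simps)
          then show False using T(2)[OF t u] that by simp
        qed
      qed
      then show "r u (b + t - u) * lam (b + t - u) u = (if u = t then r t b * lam b t else 0)" by auto
    qed
    also have "\<dots> = r t b * lam b t" using T t by simp
    finally show ?thesis by simp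
  next
    case False
    then show ?thesis by (rule twalg_outside[OF r[OF t]])
  qed
qed

end

context twmod
begin

lemma act_sum_left:
  "(\<And>i. i \<in> I \<Longrightarrow> f i \<in> twalg UNIV) \<Longrightarrow> act (\<Sum>i\<in>I. f i) m = (\<Sum>i\<in>I. act (f i) m)"
proof (induction I rule: infinite_finite_induct)
  case (insert i I)
  have "act (f i + sum f I) m = act (f i) m + act (sum f I) m"
    by (intro act_add_left twalg_sum) (use insert in auto)
  also have "act (sum f I) m = (\<Sum>i\<in>I. act (f i) m)" using insert by simp
  finally show ?case unfolding sum.insert[OF insert.hyps] .
qed (simp_all add: zero_fun_def)

lemma submodD:
  assumes "submod act (twalg B) N"
  shows submod_0: "0 \<in> N" and submod_add: "m \<in> N \<Longrightarrow> n \<in> N \<Longrightarrow> m + n \<in> N"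
    and submod_uminus: "m \<in> N \<Longrightarrow> - m \<in> N" and submod_act: "x \<in> twalg B \<Longrightarrow> m \<in> N \<Longrightarrow> act x m \<in> N"
    and submod_diff: "m \<in> N \<Longrightarrow> n \<in> N \<Longrightarrow> m - n \<in> N"
proof -
  show "0 \<in> N" "m \<in> N \<Longrightarrow> n \<in> N \<Longrightarrow> m + n \<in> N" "m \<in> N \<Longrightarrow> - m \<in> N" "x \<in> twalg B \<Longrightarrow> m \<in> N \<Longrightarrow> act x m \<in> N"
    for m n x using assms by (auto simp: submod_def)
  from this(2)[of m "- n"] this(3)[of n] show "m \<in> N \<Longrightarrow> n \<in> N \<Longrightarrow> m - n \<in> N" by simp
qed

lemma submod_scl: "submod act (twalg B) N \<Longrightarrow> 0 \<in> B \<Longrightarrow> m \<in> N \<Longrightarrow> scl c m \<in> N"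
  by (simp add: submod_iff V.subspace_scale)

lemma submod_mono: "submod act (twalg D) N \<Longrightarrow> B \<subseteq> D \<Longrightarrow> submod act (twalg B) N"
  by (auto simp: submod_def dest: twalg_mono)

lemma submod_subspace: "submod act (twalg B) N \<Longrightarrow> 0 \<in> B \<Longrightarrow> V.subspace N"
  by (simp add: submod_iff)

lemma submod_U: "submod act (twalg B) N \<Longrightarrow> b \<in> B \<Longrightarrow> m \<in> N \<Longrightarrow> U b m \<in> N"
  unfolding U_def by (auto intro!: submod_act twalg_bas)

lemma submod_sums:
  assumes "submod act (twalg B) N" "submod act (twalg B) P" "0 \<in> B"
  shows "submod act (twalg B) {x + y | x y. x \<in> N \<and> y \<in> P}"
proof -
  have "V.subspace {x + y | x y. x \<in> N \<and> y \<in> P}"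
    using assms by (intro V.subspace_sums) (auto intro: submod_subspace)
  moreover have "U b n \<in> {x + y | x y. x \<in> N \<and> y \<in> P}" if b: "b \<in> B" and n: "n \<in> {x + y | x y. x \<in> N \<and> y \<in> P}" for b n
  proof -
    obtain x y where "x \<in> N" "y \<in> P" "n = x + y" using n by blast
    then show ?thesis using b assms
      by (intro CollectI exI[of _ "U b x"] exI[of _ "U b y"]) (simp add: U_add submod_U)
  qed
  ultimately show ?thesis using assms(3) by (simp add: submod_iff)
qed

lemma submod_singleton_0: "submod act (twalg B) {0}"
  using act_zero_right by (auto simp: submod_def)

lemma submod_UNIV: "submod act R UNIV"
  by (simp add: submod_def)

lemma bspan_rep:
  assumes m: "m \<in> bspan B E" and E: "finite E"
  obtains r where "\<And>e. r e \<in> twalg B" "m = (\<Sum>e\<in>E. act (r e) e)"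
proof -
  let ?N = "{m. \<exists>r. (\<forall>e. r e \<in> twalg B) \<and> m = (\<Sum>e\<in>E. act (r e) e)}"
  have "m \<in> ?N"
  proof (rule bspan_induct[OF m])
    show "V.subspace ?N"
    proof (rule V.subspaceI)
      show "0 \<in> ?N" by (intro CollectI exI[of _ "\<lambda>_ _. 0"]) simp
    next
      fix x y assume "x \<in> ?N" "y \<in> ?N"
      then obtain r q where r: "\<forall>e. r e \<in> twalg B" "x = (\<Sum>e\<in>E. act (r e) e)"
        and q: "\<forall>e. q e \<in> twalg B" "y = (\<Sum>e\<in>E. act (q e) e)" by auto
      have "x + y = (\<Sum>e\<in>E. act (r e + q e) e)"
        unfolding r(2) q(2) sum.distrib[symmetric]
        using r(1) q(1) by (intro sum.cong refl act_add_left[symmetric]) auto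
      then show "x + y \<in> ?N" using r(1) q(1) by (intro CollectI exI[of _ "\<lambda>e. r e + q e"]) (auto intro!: twalg_add)
    next
      fix c x assume "x \<in> ?N"
      then obtain r where r: "\<forall>e. r e \<in> twalg B" "x = (\<Sum>e\<in>E. act (r e) e)" by auto
      have "scl c x = (\<Sum>e\<in>E. act (\<lambda>b. c * r e b) e)"
        unfolding r(2) V.scale_sum_right
        using r(1) by (intro sum.cong refl act_scale[symmetric]) auto
      then show "scl c x \<in> ?N" using r(1)
        by (intro CollectI exI[of _ "\<lambda>e b. c * r e b"]) (auto intro!: twalg_pointwise[where c = "\<lambda>_. c"])
    qed
  next
    fix b g assume b: "b \<in> B" and g: "g \<in> E"
    have "(\<Sum>e\<in>E. act (if e = g then bas b else (\<lambda>_. 0)) e) = (\<Sum>e\<in>E. if e = g then U b g else 0)"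
      by (intro sum.cong) (auto simp: U_def)
    also have "\<dots> = U b g" using E g by simp
    finally show "U b g \<in> ?N" using b
      by (intro CollectI exI[of _ "\<lambda>e. if e = g then bas b else (\<lambda>_. 0)"]) (auto simp: twalg_bas)
  qed
  then show thesis using that by auto
qed

lemma bspan_lincomb: "is_subgroup B \<Longrightarrow> (\<And>e. e \<in> E \<Longrightarrow> r e \<in> twalg B) \<Longrightarrow> (\<Sum>e\<in>E. act (r e) e) \<in> bspan B E"
  by (intro V.subspace_sum subspace_bspan submod_act[OF submod_bspan] bspan_base is_subgroup_zero)

text \<open>Writing \<open>c = (c - t) + t\<close> makes \<open>U c\<close> a scalar multiple of
  \<open>U (c - t)\<close> after \<open>U t\<close>.\<close>

lemma bspan_finite_index:
  assumes T: "\<And>c. c \<in> C \<Longrightarrow> \<exists>t\<in>T. c - t \<in> B"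
  shows "bspan C G \<subseteq> bspan B (gens T G)"
proof
  fix m assume "m \<in> bspan C G"
  then show "m \<in> bspan B (gens T G)"
  proof (rule bspan_induct)
    fix c g assume c: "c \<in> C" and g: "g \<in> G"
    obtain t where t: "t \<in> T" "c - t \<in> B" using T[OF c] by blast
    have "U t g \<in> gens T G" using t g by (auto simp: gens_def)
    then have "scl (inverse (lam (c - t) t)) (U (c - t) (U t g)) \<in> bspan B (gens T G)"
      using t by (intro V.subspace_scale) (auto intro: bspan_U)
    then show "U c g \<in> bspan B (gens T G)" by (simp add: U_U)
  qed simp
qed

end

text \<open>\<open>B\<close> stands for C_0 and \<open>G\<close> for generators over F*C_0. Slow
  growth and the absence of zero divisors enter as assumptions, so the arguments apply to any
  abelian group that has them.\<close>

locale fg_comm_module = twmod lam act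
  for lam :: "'a::ab_group_add \<Rightarrow> 'a \<Rightarrow> 'k::field" and act :: "('a \<Rightarrow> 'k) \<Rightarrow> 'm::ab_group_add \<Rightarrow> 'm" +
  fixes B :: "'a set" and G :: "'m set"
  assumes nondeg: "\<And>b. (\<And>a. lam a b = lam b a) \<Longrightarrow> b = 0"
    and dom: "dom_alg lam"
    and slow: "slow_growth B"
    and B: "is_subgroup B"
    and comm: "\<And>a b. a \<in> B \<Longrightarrow> b \<in> B \<Longrightarrow> lam a b = lam b a"
    and G: "finite G"
    and gen: "bspan B G = UNIV"
begin

lemma zero_B [simp]: "0 \<in> B"
  using B by (rule is_subgroup_zero)

lemma act_commute:
  assumes "x \<in> twalg B" "y \<in> twalg B"
  shows "act x (act y m) = act y (act x m)"
proof -
  have "act x (act y m) = act (tw_mult lam x y) m" using assms by (intro act_mult[symmetric]) auto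
  also have "tw_mult lam x y = tw_mult lam y x" using assms comm by (rule tw_mult_commute)
  also have "act (tw_mult lam y x) m = act y (act x m)" using assms by (intro act_mult) auto
  finally show ?thesis .
qed

lemma mult_nz: "x \<in> twalg B \<Longrightarrow> y \<in> twalg B \<Longrightarrow> x \<noteq> (\<lambda>_. 0) \<Longrightarrow> y \<noteq> (\<lambda>_. 0) \<Longrightarrow> tw_mult lam x y \<noteq> (\<lambda>_. 0)"
  using dom_algD[OF dom] by blast

text \<open>The torsion modulo \<open>N\<close> is killed by a single nonzero element: if \<open>E\<close> is a maximal independent
  set of generators modulo \<open>N\<close>, some \<open>d\<close> maps all of \<open>M\<close> into \<open>N\<close> plus the free module on \<open>E\<close>, where
  there is no torsion. This needs no Noetherian hypothesis.\<close>

lemma torsion_annihilator: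
  assumes N: "submod act (twalg UNIV) N"
  obtains d where "d \<in> twalg B" "d \<noteq> (\<lambda>_. 0)"
    "\<And>x m. x \<in> twalg B \<Longrightarrow> x \<noteq> (\<lambda>_. 0) \<Longrightarrow> act x m \<in> N \<Longrightarrow> act d m \<in> N"
proof -
  have NB: "submod act (twalg B) N" using N by (rule submod_mono) simp
  define ind where "ind E \<longleftrightarrow> (\<forall>r. (\<forall>e\<in>E. r e \<in> twalg B) \<longrightarrow> (\<Sum>e\<in>E. act (r e) e) \<in> N \<longrightarrow>
     (\<forall>e\<in>E. r e = (\<lambda>_. 0)))" for E
  have "ind {}" by (simp add: ind_def)
  moreover have "card E < Suc (card G)" if "E \<subseteq> G" for E using that G by (simp add: card_mono less_Suc_eq_le)
  ultimately obtain E where E: "E \<subseteq> G" "ind E" and Emax: "\<And>E'. E' \<subseteq> G \<Longrightarrow> ind E' \<Longrightarrow> card E' \<le> card E"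
    using ex_has_greatest_nat[of "\<lambda>E. E \<subseteq> G \<and> ind E" "{}" card "Suc (card G)"] by auto
  have fE: "finite E" using E G finite_subset by blast
  define H where "H = {x + y | x y. x \<in> N \<and> y \<in> bspan B E}"
  have H: "submod act (twalg B) H"
    unfolding H_def by (intro submod_sums NB submod_bspan B) simp
  have one: "\<exists>d\<in>twalg B. d \<noteq> (\<lambda>_. 0) \<and> act d g \<in> H" if g: "g \<in> G" for g
  proof (cases "g \<in> E")
    case True
    have "g \<in> H" unfolding H_def
      by (intro CollectI exI[of _ 0] exI[of _ g]) (use True submod_0[OF N] in \<open>auto intro: bspan_base\<close>)
    moreover have "tw_one lam \<in> twalg B" by (simp add: tw_one_def tw_scalar_in)
    moreover have "tw_one lam \<noteq> (\<lambda>_. 0)" by (auto simp: tw_one_def tw_scalar_def fun_eq_iff)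
    ultimately show ?thesis by (intro bexI[of _ "tw_one lam"]) auto
  next
    case False
    have "\<not> ind (insert g E)" using Emax[of "insert g E"] E g False fE by auto
    then obtain r where r: "\<forall>e\<in>insert g E. r e \<in> twalg B" "(\<Sum>e\<in>insert g E. act (r e) e) \<in> N"
      "\<exists>e\<in>insert g E. r e \<noteq> (\<lambda>_. 0)"
      unfolding ind_def not_all not_imp by (elim exE conjE) (rule that, simp_all)
    have s: "act (r g) g + (\<Sum>e\<in>E. act (r e) e) \<in> N" using r(2) fE False by simp
    \<comment> \<open>Otherwise the relation would involve only \<open>E\<close>, which is
      independent modulo \<open>N\<close>.\<close>
    have "r g \<noteq> (\<lambda>_. 0)"
    proof
      assume 0: "r g = (\<lambda>_. 0)"
      then have sE: "(\<Sum>e\<in>E. act (r e) e) \<in> N" using s by simp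
      have "\<forall>e\<in>E. r e \<in> twalg B" using r(1) by simp
      then have "\<forall>e\<in>E. r e = (\<lambda>_. 0)"
        using E(2)[unfolded ind_def, THEN spec, THEN mp, THEN mp] sE by blast
      then show False using bspec[of E "\<lambda>e. r e = (\<lambda>_. 0)"] r(3) 0 by (elim bexE insertE) simp_all
    qed
    moreover have "act (r g) g \<in> H"
    proof -
      have "- (\<Sum>e\<in>E. act (r e) e) \<in> bspan B E"
        using r(1) B by (intro submod_uminus[OF submod_bspan] bspan_lincomb) auto
      then show ?thesis unfolding H_def using s
        by (intro CollectI exI[of _ "act (r g) g + (\<Sum>e\<in>E. act (r e) e)"] exI[of _ "- (\<Sum>e\<in>E. act (r e) e)"]) auto
    qed
    ultimately show ?thesis using r(1) by blast
  qed
  have "\<exists>d\<in>twalg B. d \<noteq> (\<lambda>_. 0) \<and> (\<forall>g\<in>G'. act d g \<in> H)" if "G' \<subseteq> G" for G'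
    using finite_subset[OF that G] that
  proof (induction G' rule: finite_induct)
    case empty
    have "tw_one lam \<in> twalg B" by (simp add: tw_one_def tw_scalar_in)
    moreover have "tw_one lam \<noteq> (\<lambda>_. 0)" by (auto simp: tw_one_def tw_scalar_def fun_eq_iff)
    ultimately show ?case by (intro bexI[of _ "tw_one lam"]) auto
  next
    case (insert g G')
    then obtain d where d: "d \<in> twalg B" "d \<noteq> (\<lambda>_. 0)" "\<forall>g\<in>G'. act d g \<in> H" by auto
    obtain c where c: "c \<in> twalg B" "c \<noteq> (\<lambda>_. 0)" "act c g \<in> H" using one[of g] insert.prems by auto
    \<comment> \<open>A common denominator: the product moves both \<open>g\<close> and
      \<open>G'\<close> into \<open>H\<close>, since by commutativity either factor may act
      last.\<close>
    have a: "act (tw_mult lam c d) m = act c (act d m)" for m using c d by (intro act_mult) auto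
    have "act (tw_mult lam c d) g' \<in> H" if "g' \<in> insert g G'" for g'
    proof (cases "g' = g")
      case True
      then show ?thesis unfolding a act_commute[OF c(1) d(1)] using c d by (auto intro: submod_act[OF H])
    next
      case False
      then show ?thesis unfolding a using c d that by (auto intro: submod_act[OF H])
    qed
    then show ?case using mult_nz[OF c(1) d(1) c(2) d(2)] twalg_mult[OF B c(1) d(1)]
      by (intro bexI[of _ "tw_mult lam c d"] conjI ballI)
  qed
  then obtain d where d: "d \<in> twalg B" "d \<noteq> (\<lambda>_. 0)" "\<forall>g\<in>G. act d g \<in> H" by blast
  have dU: "d \<in> twalg UNIV" using d(1) by (rule twalg_UNIV_I)
  have dH: "act d m \<in> H" for m
  proof -
    have "m \<in> bspan B G" by (simp add: gen)
    then have "m \<in> {m. act d m \<in> H}"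
    proof (rule bspan_induct)
      show "V.subspace {m. act d m \<in> H}"
      proof (rule V.subspaceI)
        show "0 \<in> {m. act d m \<in> H}" using act_zero_right[OF dU] submod_0[OF H] by simp
      next
        fix x y assume "x \<in> {m. act d m \<in> H}" "y \<in> {m. act d m \<in> H}"
        then show "x + y \<in> {m. act d m \<in> H}" using act_add_right[OF dU, of x y] submod_add[OF H] by simp
      next
        fix c x assume "x \<in> {m. act d m \<in> H}"
        then show "scl c x \<in> {m. act d m \<in> H}" using act_scl[OF dU, of c x] submod_scl[OF H zero_B] by simp
      qed
      fix b g assume bg: "b \<in> B" "g \<in> G"
      have "act d (U b g) = U b (act d g)"
        unfolding U_def using bg d by (intro act_commute twalg_bas)
      then show "U b g \<in> {m. act d m \<in> H}" using bg d(3) submod_U[OF H] by simp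
    qed
    then show ?thesis by simp
  qed
  \<comment> \<open>Modulo \<open>N\<close> the element \<open>act d m\<close> is a combination
    \<open>h\<close> of \<open>E\<close>. From \<open>act x h \<in> N\<close> and the independence
    of \<open>E\<close> every product of \<open>x\<close> with a coefficient vanishes, hence so does
    every coefficient.\<close>
  have "act d m \<in> N" if x: "x \<in> twalg B" "x \<noteq> (\<lambda>_. 0)" "act x m \<in> N" for x m
  proof -
    obtain n h where nh: "act d m = n + h" "n \<in> N" "h \<in> bspan B E" using dH[of m] unfolding H_def by blast
    obtain r where r: "\<And>e. r e \<in> twalg B" "h = (\<Sum>e\<in>E. act (r e) e)" using bspan_rep[OF nh(3) fE] by blast
    have xr: "tw_mult lam x (r e) \<in> twalg B" for e using x r by (intro twalg_mult B) auto
    have "act x (act d m) \<in> N" unfolding act_commute[OF x(1) d(1)] by (rule submod_act[OF NB d(1) x(3)])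
    moreover have "act x (act d m) = act x n + act x h" unfolding nh using x by (intro act_add_right) auto
    ultimately have "act x h \<in> N"
      using submod_diff[OF NB, of "act x n + act x h" "act x n"] submod_act[OF NB x(1) nh(2)] by simp
    also have "act x h = (\<Sum>e\<in>E. act (tw_mult lam x (r e)) e)"
    proof -
      have "act x h = (\<Sum>e\<in>E. act x (act (r e) e))" unfolding r(2) using x by (intro act_sum) auto
      also have "\<dots> = (\<Sum>e\<in>E. act (tw_mult lam x (r e)) e)"
        using x r by (intro sum.cong refl act_mult[symmetric]) auto
      finally show ?thesis .
    qed
    finally have sE: "(\<Sum>e\<in>E. act (tw_mult lam x (r e)) e) \<in> N" .
    have "\<forall>e\<in>E. tw_mult lam x (r e) = (\<lambda>_. 0)"
      by (rule E(2)[unfolded ind_def, THEN spec, THEN mp, THEN mp, OF _ sE]) (use xr in blast)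
    then have "\<forall>e\<in>E. r e = (\<lambda>_. 0)" using mult_nz[OF x(1) r(1) x(2)] by blast
    then have "h = 0" using r(2) by simp
    then show ?thesis using nh by simp
  qed
  then show thesis using d that by blast
qed

text \<open>The elements that map \<open>T\<close> into \<open>N\<close> are closed under conjugation by \<open>A\<close>, so by nondegeneracy
  of the commutator pairing they are all or nothing.\<close>

lemma transporter_all_or_nothing:
  assumes D: "is_subgroup D" and N: "submod act (twalg UNIV) N" and UT: "\<And>a m. m \<in> T \<Longrightarrow> U a m \<in> T"
    and d: "d \<in> twalg D" "d \<noteq> (\<lambda>_. 0)" "\<And>m. m \<in> T \<Longrightarrow> act d m \<in> N"
  shows "T \<subseteq> N"
proof -
  define J where "J = {y \<in> twalg D. \<forall>m\<in>T. act y m \<in> N}"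
  have "tw_one lam \<in> J"
  proof (rule tw_one_in_conj_invariant[OF nondeg D])
    show "J \<subseteq> twalg D" by (auto simp: J_def)
    show "d \<in> J" "d \<noteq> (\<lambda>_. 0)" using d unfolding J_def by auto
    show "x - y \<in> J" if xy: "x \<in> J" "y \<in> J" for x y
    proof -
      have "act (x - y) m = act x m - act y m" for m using xy by (intro act_diff_left) (auto simp: J_def)
      then show ?thesis using xy twalg_diff submod_diff[OF N] unfolding J_def by auto
    qed
    show "(\<lambda>b. c * x b) \<in> J" if xJ: "x \<in> J" for c x
    proof -
      have "act (\<lambda>b. c * x b) m = scl c (act x m)" for m using xJ by (intro act_scale) (auto simp: J_def)
      then show ?thesis
        using xJ twalg_pointwise[of x D "\<lambda>_. c"] submod_scl[OF N] unfolding J_def by auto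
    qed
    show "conj a x \<in> J" if xJ: "x \<in> J" for a x
    proof -
      have "act (conj a x) m \<in> N" if mT: "m \<in> T" for m
      proof -
        \<comment> \<open>Up to the nonzero scalar \<open>c\<close>, \<open>m\<close> is
          \<open>U a\<close> of \<open>U (- a) m\<close>, and the latter is again in
          \<open>T\<close>; so \<open>x\<close> may be applied to it before returning with
          \<open>U a\<close>.\<close>
        define c where "c = lam a (- a) * lam 0 0"
        have c: "c \<noteq> 0" by (simp add: c_def)
        have "act (conj a x) (scl c m) = act (conj a x) (U a (U (- a) m))"
          by (simp add: U_uminus_inv c_def)
        also have "\<dots> = U a (act x (U (- a) m))" using xJ by (intro U_act[symmetric]) (auto simp: J_def)
        also have "\<dots> \<in> N" using UT[OF mT] xJ submod_U[OF N] by (simp add: J_def)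
        finally have "act (conj a x) (scl c m) \<in> N" .
        then have "scl (inverse c) (act (conj a x) (scl c m)) \<in> N" by (intro submod_scl[OF N]) auto
        also have "act (conj a x) (scl c m) = scl c (act (conj a x) m)"
          using xJ twalg_conj by (intro act_scl) (auto simp: J_def)
        finally show ?thesis using c by simp
      qed
      then show ?thesis using xJ twalg_conj unfolding J_def by auto
    qed
    show "tw_mult lam (bas b) x \<in> J" if b: "b \<in> D" and xJ: "x \<in> J" for b x
    proof -
      have "act (tw_mult lam (bas b) x) m = U b (act x m)" for m
        unfolding U_def using xJ by (intro act_mult) (auto simp: J_def)
      then show ?thesis
        using xJ twalg_mult[OF D twalg_bas[OF b]] submod_U[OF N] unfolding J_def by auto
    qed
  qed
  then show ?thesis by (auto simp: J_def)
qed

text \<open>\<open>conj a x\<close> is again a nonzero element of F*B, so the torsion set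
  \<open>T\<close> modulo \<open>N\<close> is stable under every \<open>U a\<close>; the common
  annihilator then forces \<open>T\<close> into \<open>N\<close>.\<close>

lemma torsion_mod:
  assumes N: "submod act (twalg UNIV) N" and x: "x \<in> twalg B" "x \<noteq> (\<lambda>_. 0)" and m: "act x m \<in> N"
  shows "m \<in> N"
proof -
  define T where "T = {m. \<exists>x\<in>twalg B. x \<noteq> (\<lambda>_. 0) \<and> act x m \<in> N}"
  obtain d where d: "d \<in> twalg B" "d \<noteq> (\<lambda>_. 0)"
    "\<And>x m. x \<in> twalg B \<Longrightarrow> x \<noteq> (\<lambda>_. 0) \<Longrightarrow> act x m \<in> N \<Longrightarrow> act d m \<in> N" using torsion_annihilator[OF N] by blast
  have UT: "U a m \<in> T" if mT: "m \<in> T" for a m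
  proof -
    obtain x where x: "x \<in> twalg B" "x \<noteq> (\<lambda>_. 0)" "act x m \<in> N" using mT unfolding T_def by auto
    have "act (conj a x) (U a m) = U a (act x m)" using x by (intro U_act[symmetric]) auto
    also have "\<dots> \<in> N" using x submod_U[OF N] by simp
    finally show ?thesis unfolding T_def using x
      by (intro CollectI bexI[of _ "conj a x"]) (simp_all add: twalg_conj conj_eq_0)
  qed
  have "T \<subseteq> N" by (rule transporter_all_or_nothing[OF B N UT d(1,2)]) (use d(3) in \<open>auto simp: T_def\<close>)
  moreover have "m \<in> T" using x m by (auto simp: T_def)
  ultimately show ?thesis by blast
qed

section \<open>Rank over the commutative subalgebra\<close>

definition rk :: "'m set \<Rightarrow> nat" where
  "rk N = Max {card W | W. finite W \<and> W \<subseteq> N \<and> bindep B W (\<lambda>w. w)}"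

lemma
  shows rk_witness: "\<exists>W. finite W \<and> W \<subseteq> N \<and> bindep B W (\<lambda>w. w) \<and> card W = rk N"
    and rk_ge: "finite W \<Longrightarrow> W \<subseteq> N \<Longrightarrow> bindep B W (\<lambda>w. w) \<Longrightarrow> card W \<le> rk N"
proof -
  let ?X = "{card W | W. finite W \<and> W \<subseteq> N \<and> bindep B W (\<lambda>w. w)}"
  have "card W \<le> card G" if "finite W" "bindep B W (\<lambda>w. w)" for W
    using bindep_card_le[OF slow B that(1) G that(2)] gen by simp
  then have "?X \<subseteq> {..card G}" by auto
  then have fin: "finite ?X" using finite_subset by blast
  have "bindep B {} (\<lambda>w. w)" by (simp add: bindep_def)
  then have ne: "?X \<noteq> {}" by blast
  show "\<exists>W. finite W \<and> W \<subseteq> N \<and> bindep B W (\<lambda>w. w) \<and> card W = rk N"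
    using Max_in[OF fin ne] unfolding rk_def by force
  show "card W \<le> rk N" if "finite W" "W \<subseteq> N" "bindep B W (\<lambda>w. w)"
    unfolding rk_def using that by (intro Max_ge fin) blast
qed

text \<open>An element outside \<open>N\<close> extends every independent family in
  \<open>N\<close>: in a relation its multiple lies in \<open>N\<close>, so its coefficient is 0 by
  torsion-freeness modulo \<open>N\<close>.\<close>

lemma rk_strict_mono:
  assumes N: "submod act (twalg UNIV) N" and N': "N \<subset> N'"
  shows "rk N < rk N'"
proof -
  obtain W where W: "finite W" "W \<subseteq> N" "bindep B W (\<lambda>w. w)" "card W = rk N" using rk_witness by blast
  obtain m where m: "m \<in> N'" "m \<notin> N" using N' by blast
  have mW: "m \<notin> W" using m W by blast
  have NB: "submod act (twalg B) N" using N by (rule submod_mono) simp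
  have "bindep B (insert m W) (\<lambda>w. w)"
    unfolding bindep_def
  proof (intro allI impI)
    fix r assume r: "\<forall>i\<in>insert m W. r i \<in> twalg B" and s: "(\<Sum>i\<in>insert m W. act (r i) i) = 0"
    have s': "act (r m) m + (\<Sum>i\<in>W. act (r i) i) = 0" using s W mW by simp
    have "(\<Sum>i\<in>W. act (r i) i) \<in> N"
      using W r submod_act[OF NB] by (intro V.subspace_sum submod_subspace[OF NB]) auto
    then have "act (r m) m \<in> N" using s' submod_uminus[OF NB] by (metis eq_neg_iff_add_eq_0)
    then have rm: "r m = (\<lambda>_. 0)" using torsion_mod[OF N] r m by blast
    then have sW: "(\<Sum>i\<in>W. act (r i) i) = 0" using s' by simp
    have "\<forall>i\<in>W. r i \<in> twalg B" using r by simp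
    then have "\<forall>i\<in>W. r i = (\<lambda>_. 0)"
      using W(3)[unfolded bindep_def, THEN spec, THEN mp, THEN mp] sW by blast
    then show "\<forall>i\<in>insert m W. r i = (\<lambda>_. 0)" using rm by simp
  qed
  then have "card (insert m W) \<le> rk N'" using W m N' by (intro rk_ge) auto
  then show ?thesis using W mW by simp
qed

lemma torsion_free_B: "torsion_free act (twalg B)"
  unfolding torsion_free_def using torsion_mod[OF submod_singleton_0] by blast

lemma artinian: "artinian_mod act (twalg UNIV)"
  unfolding artinian_mod_def
proof
  assume "\<exists>f. (\<forall>i. submod act (twalg UNIV) (f i)) \<and> (\<forall>i. f (Suc i) \<subset> (f i :: 'm set))"
  then obtain f :: "nat \<Rightarrow> 'm set" where f: "\<And>i. submod act (twalg UNIV) (f i)" "\<And>i. f (Suc i) \<subset> f i" by blast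
  have "rk (f i) + i \<le> rk (f 0)" for i
  proof (induction i)
    case (Suc i)
    then show ?case using rk_strict_mono[OF f(1) f(2), of i] by simp
  qed simp
  from this[of "Suc (rk (f 0))"] show False by simp
qed

text \<open>More than \<open>card G\<close> translates \<open>U t m\<close> are dependent over F*B.
  Such a relation is the action of a single element of F*A on \<open>m\<close>, nonzero because the
  \<open>t\<close> are incongruent modulo \<open>B\<close>.\<close>

lemma annihilator_nonzero:
  assumes T: "finite T" "\<And>s t. s \<in> T \<Longrightarrow> t \<in> T \<Longrightarrow> s - t \<in> B \<Longrightarrow> s = t" "card T > card G"
  obtains x where "x \<in> twalg UNIV" "x \<noteq> (\<lambda>_. 0)" "act x m = 0"
proof -
  have "\<not> bindep B T (\<lambda>t. U t m)"
    using bindep_card_le[OF slow B T(1) G, of "\<lambda>t. U t m"] gen T(3) by auto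
  then obtain r where r: "\<forall>t\<in>T. r t \<in> twalg B" "(\<Sum>t\<in>T. act (r t) (U t m)) = 0" "\<exists>t\<in>T. r t \<noteq> (\<lambda>_. 0)"
    unfolding bindep_def not_all not_imp by (elim exE conjE) (rule that, simp_all)
  define x where "x = (\<Sum>t\<in>T. tw_mult lam (r t) (bas t))"
  have mem: "tw_mult lam (r t) (bas t) \<in> twalg UNIV" if "t \<in> T" for t
    using r(1) that by (intro twalg_mult) auto
  show thesis
  proof (rule that)
    show "x \<in> twalg UNIV" unfolding x_def using mem by (rule twalg_sum)
    show "x \<noteq> (\<lambda>_. 0)"
      using transversal_sum_eq_0[OF T(1,2) B, of r] r(1,3) unfolding x_def by blast
    have "act x m = (\<Sum>t\<in>T. act (tw_mult lam (r t) (bas t)) m)"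
      unfolding x_def using mem by (rule act_sum_left)
    also have "\<dots> = (\<Sum>t\<in>T. act (r t) (U t m))"
      unfolding U_def using r(1) by (intro sum.cong refl act_mult) auto
    finally show "act x m = 0" using r(2) by simp
  qed
qed

text \<open>Simplicity of F*A in the form that cyclicity uses: nonzero subquotients are
  faithful.\<close>

lemma act_not_into_smaller:
  assumes N: "submod act (twalg UNIV) N" and N': "submod act (twalg UNIV) N'" and nle: "\<not> N \<subseteq> N'"
    and x: "x \<in> twalg UNIV" "x \<noteq> (\<lambda>_. 0)"
  shows "\<exists>n\<in>N. act x n \<notin> N'"
  using transporter_all_or_nothing[OF is_subgroup_UNIV N' _ x, of N] submod_U[OF N] nle by blast

text \<open>Among the submodules \<open>N\<close> that together with one cyclic submodule span the
  module, take one of least rank. If it were nonzero, changing the cyclic generator by an element of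
  \<open>N\<close> would allow a proper submodule of \<open>N\<close> in its place.\<close>

lemma cyclic:
  assumes inf: "\<And>n. \<exists>T. finite T \<and> card T > n \<and> (\<forall>s\<in>T. \<forall>t\<in>T. s - t \<in> B \<longrightarrow> s = t)"
  shows "cyclic_mod act (twalg UNIV)"
proof -
  define sub where "sub = submod act (twalg UNIV)"
  define P where "P N \<longleftrightarrow> sub N \<and> (\<exists>m. \<forall>v. v \<in> {x + y | x y. x \<in> bspan UNIV {m} \<and> y \<in> N})" for N
  have sb: "sub (bspan UNIV E)" for E unfolding sub_def by (rule submod_bspan) simp
  have "v \<in> {x + y | x y. x \<in> bspan UNIV {0} \<and> y \<in> UNIV}" for v
    using submod_0[OF sb[of "{0}", unfolded sub_def]] by (intro CollectI exI[of _ 0] exI[of _ v]) simp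
  then have "P UNIV" unfolding P_def sub_def using submod_UNIV by blast
  then obtain N where N: "P N" and Nmin: "\<And>N'. P N' \<Longrightarrow> rk N \<le> rk N'"
    using ex_has_least_nat[of P UNIV rk] by auto
  have sN: "sub N" using N by (simp add: P_def)
  obtain m where m: "\<And>v. v \<in> {x + y | x y. x \<in> bspan UNIV {m} \<and> y \<in> N}" using N unfolding P_def by blast
  have "N = {0}"
  proof (rule ccontr)
    assume "N \<noteq> {0}"
    then have "sub {0} \<and> {0} \<subset> N" using submod_0[OF sN[unfolded sub_def]] submod_singleton_0 by (auto simp: sub_def)
    moreover have "rk N' < rk N" if "sub N' \<and> N' \<subset> N" for N' using rk_strict_mono that by (simp add: sub_def)
    \<comment> \<open>Since the rank grows strictly, a proper submodule of greatest rank is a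
      maximal submodule of \<open>N\<close>.\<close>
    ultimately obtain N' where N': "sub N'" "N' \<subset> N" and N'max: "\<And>L. sub L \<Longrightarrow> L \<subset> N \<Longrightarrow> rk L \<le> rk N'"
      using ex_has_greatest_nat[of "\<lambda>N'. sub N' \<and> N' \<subset> N" "{0}" rk "rk N"] by blast
    obtain T where T: "finite T" "card T > card G" "\<forall>s\<in>T. \<forall>t\<in>T. s - t \<in> B \<longrightarrow> s = t" using inf by blast
    obtain x where x: "x \<in> twalg UNIV" "x \<noteq> (\<lambda>_. 0)" "act x m = 0"
      using annihilator_nonzero[OF T(1) _ T(2), of m] T(3) by blast
    \<comment> \<open>\<open>x\<close> kills \<open>m\<close> but moves \<open>n\<close> out of
      \<open>N'\<close>; applied to \<open>m + n\<close> it therefore produces an element of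
      \<open>N\<close> outside \<open>N'\<close>.\<close>
    obtain n where n: "n \<in> N" "act x n \<notin> N'"
      using act_not_into_smaller[of N N' x] sN N' x unfolding sub_def by blast
    define L where "L = {x + y | x y. x \<in> bspan UNIV {m + n} \<and> y \<in> N'}"
    have sL: "sub L" unfolding L_def sub_def
      by (intro submod_sums) (use sb N' in \<open>auto simp: sub_def\<close>)
    have L1: "bspan UNIV {m + n} \<subseteq> L"
      unfolding L_def using submod_0[OF N'(1)[unfolded sub_def]] by force
    have L2: "N' \<subseteq> L"
      unfolding L_def using submod_0[OF sb[of "{m + n}", unfolded sub_def]] by force
    have mn: "m + n \<in> L" using L1 bspan_base[of UNIV "m + n" "{m + n}"] by auto
    then have "act x (m + n) \<in> L" using x sL unfolding sub_def by (intro submod_act)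
    then have xn: "act x n \<in> L" using x by (simp add: act_add_right)
    have sLN: "sub (L \<inter> N)" using sL sN by (auto simp: sub_def submod_def)
    have xnN: "act x n \<in> N" using sN n x unfolding sub_def by (intro submod_act)
    have "N' \<subset> L \<inter> N" using L2 N' xn xnN n by blast
    then have "rk N' < rk (L \<inter> N)" using rk_strict_mono N' by (simp add: sub_def)
    \<comment> \<open>Maximality of \<open>N'\<close> forces \<open>N\<close> into \<open>L\<close>.
      Then \<open>m = (m + n) - n\<close> is in \<open>L\<close> as well, and \<open>L\<close> is
      everything.\<close>
    then have "L \<inter> N = N" using N'max[OF sLN] by (metis inf_le2 leD order_less_le)
    then have NL: "N \<subseteq> L" by blast
    have "m + n - n \<in> L" using NL n mn sL unfolding sub_def by (intro submod_diff) auto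
    then have "bspan UNIV {m} \<subseteq> L" using sL unfolding sub_def by (intro bspan_least) auto
    then have "v \<in> L" for v using m[of v] NL sL submod_add unfolding sub_def by blast
    then have "P N'" unfolding P_def using N' L_def by auto
    then have "rk N \<le> rk N'" by (rule Nmin)
    then show False using rk_strict_mono[of N' N] N' by (simp add: sub_def)
  qed
  then have "bspan UNIV {m} = UNIV" using m by auto
  then show ?thesis unfolding cyclic_mod_def gen_submod_eq[OF is_subgroup_UNIV] by blast
qed

text \<open>Over F*B the algebra F*C is spanned by \<open>card T\<close> elements, so 1 and the
  products of the basis elements of \<open>T\<close> with \<open>x\<close> are dependent. The
  coefficient of 1 is a nonzero element of F*B that kills whatever \<open>x\<close> kills.\<close>

lemma torsion_free_finite_index:
  assumes C: "is_subgroup C" "B \<subseteq> C" and T: "finite T" "T \<subseteq> C"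
    and T1: "\<And>c. c \<in> C \<Longrightarrow> \<exists>t\<in>T. c - t \<in> B"
    and T2: "\<And>s t. s \<in> T \<Longrightarrow> t \<in> T \<Longrightarrow> s - t \<in> B \<Longrightarrow> s = t"
  shows "torsion_free act (twalg C)"
  unfolding torsion_free_def
proof (intro ballI allI impI)
  fix x m assume x: "x \<in> twalg C" "x \<noteq> (\<lambda>_. 0)" and xm: "act x m = 0"
  interpret R: twmod lam "tw_mult lam" by unfold_locales (rule tw_module_mult)
  \<comment> \<open>\<open>None\<close> indexes the identity and \<open>Some t\<close> the product
    for \<open>t\<close>, giving exactly one vector more than the spanning set has.\<close>
  define w where "w = (\<lambda>i. case i of None \<Rightarrow> tw_one lam | Some t \<Rightarrow> tw_mult lam (bas t) x)"
  define I where "I = insert None (Some ` T)"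
  have I: "finite I" using T by (simp add: I_def)
  have xU: "x \<in> twalg UNIV" using x by auto
  have cI: "card I = Suc (card T)" using T by (simp add: I_def card_image)
  have mem: "y \<in> R.bspan B (bas ` T)" if y: "y \<in> twalg C" for y
  proof -
    have b: "bas c \<in> R.bspan B (bas ` T)" if c: "c \<in> C" for c
    proof -
      obtain t where t: "t \<in> T" "c - t \<in> B" using T1[OF c] by blast
      have "R.scl (inverse (lam (c - t) t)) (R.U (c - t) (bas t)) \<in> R.bspan B (bas ` T)"
        using t by (intro R.V.subspace_scale R.subspace_bspan R.bspan_U) auto
      also have "R.scl (inverse (lam (c - t) t)) (R.U (c - t) (bas t)) = bas c"
        by (rule ext) (simp add: scal_def tw_scalar_mult R.U_def bas_mult_bas)
      finally show ?thesis .
    qed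
    have fy: "finite (fsupp y)" using y by (simp add: twalg_def)
    have "y = (\<Sum>a\<in>fsupp y. R.scl (y a) (bas a))"
    proof
      fix p
      have "(\<Sum>a\<in>fsupp y. R.scl (y a) (bas a)) p = (\<Sum>a\<in>fsupp y. if a = p then y p else 0)"
        unfolding sum_fun_eval by (intro sum.cong) (auto simp: scal_def tw_scalar_mult bas_def)
      also have "\<dots> = y p" using fy by (auto simp: fsupp_def)
      finally show "y p = (\<Sum>a\<in>fsupp y. R.scl (y a) (bas a)) p" by simp
    qed
    also have "\<dots> \<in> R.bspan B (bas ` T)"
      using y b by (intro R.V.subspace_sum R.V.subspace_scale R.subspace_bspan) (auto simp: twalg_def)
    finally show ?thesis .
  qed
  have "w i \<in> twalg C" if "i \<in> I" for i
    using that T C x unfolding I_def w_def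
    by (auto simp: tw_one_def is_subgroup_zero intro!: tw_scalar_in twalg_mult twalg_bas)
  then have wI: "w ` I \<subseteq> R.bspan B (bas ` T)" using mem by auto
  have "\<not> R.bindep B I w"
  proof
    assume "R.bindep B I w"
    then have "card I \<le> card (bas ` T :: ('a \<Rightarrow> 'k) set)"
      using R.bindep_card_le[OF slow B I _ _ wI] T by simp
    also have "\<dots> \<le> card T" using T by (intro card_image_le)
    finally show False using cI by simp
  qed
  then obtain r where r: "\<forall>i\<in>I. r i \<in> twalg B" "(\<Sum>i\<in>I. tw_mult lam (r i) (w i)) = 0"
    "\<exists>i\<in>I. r i \<noteq> (\<lambda>_. 0)"
    unfolding R.bindep_def not_all not_imp by (elim exE conjE) (rule that, simp_all)
  define y where "y = (\<Sum>t\<in>T. tw_mult lam (r (Some t)) (bas t))"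
  have rS: "r (Some t) \<in> twalg B" if "t \<in> T" for t using r(1) that by (auto simp: I_def)
  have rN: "r None \<in> twalg B" using r(1) by (auto simp: I_def)
  have memy: "tw_mult lam (r (Some t)) (bas t) \<in> twalg UNIV" if "t \<in> T" for t
    using rS[OF that] by (intro twalg_mult) auto
  have yU: "y \<in> twalg UNIV" unfolding y_def using memy by (rule twalg_sum)
  have yx: "tw_mult lam y x = (\<Sum>t\<in>T. tw_mult lam (r (Some t)) (tw_mult lam (bas t) x))"
  proof -
    have "tw_mult lam y x = (\<Sum>t\<in>T. tw_mult lam (tw_mult lam (r (Some t)) (bas t)) x)"
      unfolding y_def using memy by (rule R.act_sum_left)
    also have "\<dots> = (\<Sum>t\<in>T. tw_mult lam (r (Some t)) (tw_mult lam (bas t) x))"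
      using rS by (intro sum.cong refl tw_mult_assoc) auto
    finally show ?thesis .
  qed
  have "(\<Sum>i\<in>I. tw_mult lam (r i) (w i)) = tw_mult lam (r None) (tw_one lam) + tw_mult lam y x"
    unfolding I_def yx using T by (subst sum.insert) (auto simp: sum.reindex w_def)
  then have eq: "tw_mult lam (r None) (tw_one lam) + tw_mult lam y x = 0" using r(2) by simp
  \<comment> \<open>Otherwise \<open>y\<close> times \<open>x\<close> vanishes, so
    \<open>y = 0\<close>, and freeness over the transversal kills the remaining
    coefficients.\<close>
  have nz: "r None \<noteq> (\<lambda>_. 0)"
  proof
    assume 0: "r None = (\<lambda>_. 0)"
    then have "tw_mult lam y x = (\<lambda>_. 0)" using eq by (simp add: zero_fun_def)
    then have "y = (\<lambda>_. 0)" using dom_algD[OF dom yU xU] x by blast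
    then have "r (Some t) = (\<lambda>_. 0)" if "t \<in> T" for t
      using transversal_sum_eq_0[OF T(1) T2 B, of "\<lambda>t. r (Some t)"] rS that unfolding y_def by blast
    then show False using r(3) 0 by (auto simp: I_def)
  qed
  have rU: "r None \<in> twalg UNIV" using rN by auto
  have "act (tw_mult lam (r None) (tw_one lam) + tw_mult lam y x) m = act (r None) m + act y (act x m)"
    using rU yU xU by (simp add: act_add_left act_mult twalg_mult)
  then have "act (r None) m = 0" using eq yU xm by (simp add: act_zero_right zero_fun_def)
  then show "m = 0" using torsion_free_B rN nz unfolding torsion_free_def by blast
qed

end

section \<open>Commutative subgroups have infinite index\<close>

context cocycle
begin

text \<open>Such a basis element commutes with the whole algebra, hence is a scalar: this is
  nondegeneracy of \<open>chi\<close>.\<close>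

lemma central_basis_element:
  assumes "tw_center lam = {z. \<forall>a. a \<noteq> 0 \<longrightarrow> z a = 0}" and "\<And>a. lam a b = lam b a"
  shows "b = 0"
proof (rule ccontr)
  assume "b \<noteq> 0"
  have "bas b \<in> tw_center lam"
    unfolding tw_center_def using assms(2) by (auto simp: bas_mult mult_bas)
  then have "bas b b = (0 :: 'k)" using assms(1) \<open>b \<noteq> 0\<close> by simp
  then show False by (simp add: bas_def)
qed

lemma lam_commute_of_tw_mult_commute:
  assumes "\<forall>x\<in>twalg B. \<forall>y\<in>twalg B. tw_mult lam x y = tw_mult lam y x" "a \<in> B" "b \<in> B"
  shows "lam a b = lam b a"
proof -
  have "tw_mult lam (bas a) (bas b) (a + b) = tw_mult lam (bas b) (bas a) (a + b)"
    using assms twalg_bas by metis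
  then show ?thesis unfolding bas_mult_bas by (simp add: bas_def add.commute)
qed

end

lemma finite_index_transversal:
  assumes B: "is_subgroup B" and fi: "finite_index B C"
  obtains T where "finite T" "T \<subseteq> C" "\<And>c. c \<in> C \<Longrightarrow> \<exists>t\<in>T. c - t \<in> B"
    "\<And>s t. s \<in> T \<Longrightarrow> t \<in> T \<Longrightarrow> s - t \<in> B \<Longrightarrow> s = t"
proof -
  let ?cs = "\<lambda>c. (\<lambda>d. c + d) ` B"
  define h where "h X = (SOME c. c \<in> C \<and> X = ?cs c)" for X
  have h: "h X \<in> C \<and> X = ?cs (h X)" if "X \<in> ?cs ` C" for X
    unfolding h_def by (rule someI_ex) (use that in blast)
  show thesis
  proof (rule that[of "h ` ?cs ` C"])
    show "finite (h ` ?cs ` C)" using fi unfolding finite_index_def by (rule finite_imageI)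
    show "h ` ?cs ` C \<subseteq> C" using h by blast
  next
    fix c assume c: "c \<in> C"
    have "c + 0 \<in> ?cs c" using is_subgroup_zero[OF B] by (rule imageI)
    then have "c \<in> ?cs c" by simp
    also have "?cs c = ?cs (h (?cs c))" using h c by blast
    finally obtain b where b: "b \<in> B" "c = h (?cs c) + b" by blast
    then have "c - h (?cs c) \<in> B" by (metis add_diff_cancel_left')
    then show "\<exists>t\<in>h ` ?cs ` C. c - t \<in> B" using c by blast
  next
    fix s t assume s: "s \<in> h ` ?cs ` C" and t: "t \<in> h ` ?cs ` C" and st: "s - t \<in> B"
    obtain X where X: "X \<in> ?cs ` C" "s = h X" using s by blast
    obtain Y where Y: "Y \<in> ?cs ` C" "t = h Y" using t by blast
    have sub: "?cs u \<subseteq> ?cs v" if "u - v \<in> B" for u v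
    proof
      fix w assume "w \<in> ?cs u"
      then obtain b where b: "b \<in> B" "w = u + b" by blast
      have "v + ((u - v) + b) \<in> ?cs v" using is_subgroup_add[OF B that b(1)] by (rule imageI)
      then show "w \<in> ?cs v" using b by (simp add: algebra_simps)
    qed
    have "t - s \<in> B" using is_subgroup_uminus[OF B st] by simp
    then have "?cs s = ?cs t" by (rule subset_antisym[OF sub[OF st] sub])
    then have "X = Y" using h X Y by metis
    then show "s = t" using X Y by simp
  qed
qed

lemma is_subgroup_nat_multiple:
  fixes a :: "int ^ 'n"
  assumes "is_subgroup B" "a \<in> B"
  shows "int k *s a \<in> B"
proof (induction k)
  case 0
  have "int 0 *s a = 0" by (simp add: vec_eq_iff)
  then show ?case using is_subgroup_zero[OF assms(1)] by simp
next
  case (Suc k)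
  have "int (Suc k) *s a = a + int k *s a" by (simp add: vec_eq_iff algebra_simps)
  then show ?case using Suc is_subgroup_add[OF assms(1,2)] by simp
qed

text \<open>Bounded sizes give a largest set of pairwise incongruent elements, and a coset it missed
  could be used to enlarge it.\<close>

lemma bounded_transversals_imp_finite_cover:
  fixes B :: "'a::ab_group_add set"
  assumes "\<not> (\<exists>T. finite T \<and> card T > n \<and> (\<forall>s\<in>T. \<forall>t\<in>T. s - t \<in> B \<longrightarrow> s = t))" and B: "is_subgroup B"
  shows "\<exists>T. finite T \<and> (\<forall>a. \<exists>t\<in>T. a - t \<in> B)"
proof -
  define P where "P T \<longleftrightarrow> finite T \<and> (\<forall>s\<in>T. \<forall>t\<in>T. s - t \<in> B \<longrightarrow> s = t)" for T :: "'a set"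
  have "P {}" by (simp add: P_def)
  moreover have "\<forall>T. P T \<longrightarrow> card T < Suc n"
    using assms(1) unfolding P_def by (metis less_Suc_eq_le not_less)
  ultimately obtain T where T: "P T" and Tmax: "\<And>T'. P T' \<Longrightarrow> card T' \<le> card T"
    using ex_has_greatest_nat[of P "{}" card "Suc n"] by blast
  have "\<exists>t\<in>T. a - t \<in> B" for a
  proof (rule ccontr)
    assume neg: "\<not> (\<exists>t\<in>T. a - t \<in> B)"
    have aT: "a \<notin> T" using neg is_subgroup_zero[OF B] by force
    have "t - a \<notin> B" if "t \<in> T" for t using neg that is_subgroup_uminus[OF B, of "t - a"] by auto
    then have "P (insert a T)" using T neg unfolding P_def by auto
    then have "card (insert a T) \<le> card T" by (rule Tmax)
    then show False using T aT by (simp add: P_def)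
  qed
  then show ?thesis using T unfolding P_def by blast
qed

text \<open>Finite index would give \<open>N > 0\<close> with all multiples \<open>N a\<close> in
  \<open>B\<close>. Then \<open>chi (N^2 a) b = chi (N a) (N b) = 1\<close> for all
  \<open>b\<close>, against nondegeneracy.\<close>

lemma commutative_infinite_index:
  fixes lam :: "int ^ 'n \<Rightarrow> int ^ 'n \<Rightarrow> 'k::field"
  assumes "two_cocycle lam"
    and nondeg: "\<And>b. (\<And>a. lam a b = lam b a) \<Longrightarrow> b = 0"
    and B: "is_subgroup B" and comm: "\<And>a b. a \<in> B \<Longrightarrow> b \<in> B \<Longrightarrow> lam a b = lam b a"
  shows "\<exists>T. finite T \<and> card T > n \<and> (\<forall>s\<in>T. \<forall>t\<in>T. s - t \<in> B \<longrightarrow> s = t)"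
proof (rule ccontr)
  interpret cocycle lam by unfold_locales (rule assms(1))
  assume neg: "\<not> ?thesis"
  obtain T where T: "finite T" "\<And>a. \<exists>t\<in>T. a - t \<in> B"
    using bounded_transversals_imp_finite_cover[OF neg B] by (elim exE conjE) (rule that, assumption, erule spec)
  \<comment> \<open>By pigeonhole every element has a positive multiple in \<open>B\<close> with
    factor at most \<open>card T\<close>; the factorial is divisible by all these factors.\<close>
  define N where "N = (fact (card T) :: nat)"
  have N0: "N \<noteq> 0" by (simp add: N_def)
  have NB: "int N *s a \<in> B" for a
  proof -
    obtain f where f: "\<And>a. f a \<in> T" "\<And>a. a - f a \<in> B" using T(2) by metis
    have "card ((\<lambda>i. f (int i *s a)) ` {0..card T}) \<le> card T" using f T by (intro card_mono) auto
    then have "\<not> inj_on (\<lambda>i. f (int i *s a)) {0..card T}" by (intro pigeonhole) simp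
    then obtain i j where ij: "i < j" "j \<le> card T" "f (int i *s a) = f (int j *s a)"
      unfolding inj_on_def by (metis atLeastAtMost_iff linorder_neqE_nat)
    have "(int j *s a - f (int j *s a)) - (int i *s a - f (int i *s a)) \<in> B"
      by (rule is_subgroup_diff[OF B f(2) f(2)])
    moreover have "(int j *s a - f (int j *s a)) - (int i *s a - f (int i *s a)) = int (j - i) *s a"
      using ij by (simp add: vec_eq_iff of_nat_diff algebra_simps)
    ultimately have "int (j - i) *s a \<in> B" by simp
    moreover have "(j - i) dvd N" unfolding N_def using ij by (intro dvd_fact) auto
    then obtain q where q: "N = (j - i) * q" by (elim dvdE)
    ultimately have "int q *s (int (j - i) *s a) \<in> B" using is_subgroup_nat_multiple[OF B] by blast
    also have "int q *s (int (j - i) *s a) = int N *s a"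
      unfolding q of_nat_mult by (simp add: vec_eq_iff mult_ac)
    finally show ?thesis .
  qed
  have chi_left: "chi (int k *s a) b = chi a b ^ k" for k a b
  proof (induction k)
    case 0
    have "int 0 *s a = 0" by (simp add: vec_eq_iff)
    then show ?case by simp
  next
    case (Suc k)
    have "int (Suc k) *s a = a + int k *s a" by (simp add: vec_eq_iff algebra_simps)
    then show ?case using Suc by (simp add: chi_add_left)
  qed
  have chi_right: "chi a (int k *s b) = chi a b ^ k" for k a b
    using chi_left[of k b a] chi_sym[of a "int k *s b"] chi_sym[of a b] by (simp add: power_inverse)
  \<comment> \<open>The index type is nonempty, so the all-ones vector is nonzero.\<close>
  define a :: "int ^ 'n" where "a = (\<chi> i. 1)"
  have "chi (int (N * N) *s a) b = 1" for b
  proof -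
    have "chi (int (N * N) *s a) b = chi (int N *s a) (int N *s b)"
      unfolding chi_left chi_right by (simp add: power_mult)
    also have "\<dots> = 1" unfolding chi_eq_1 by (rule comm[OF NB NB])
    finally show ?thesis .
  qed
  then have "lam b (int (N * N) *s a) = lam (int (N * N) *s a) b" for b
    by (simp add: chi_eq_1)
  then have "int (N * N) *s a = 0" by (rule nondeg)
  then show False using N0 by (simp add: vec_eq_iff a_def)
qed

section \<open>Gelfand-Kirillov dimension\<close>

lemma words_0: "words act 0 X Y = Y"
  by (auto simp: words_def)

lemma words_Suc: "words act (Suc k) X Y = (\<lambda>(x, w). act x w) ` (X \<times> words act k X Y)"
proof (intro set_eqI iffI)
  fix w assume "w \<in> words act (Suc k) X Y"
  then obtain xs y where xs: "w = foldr act xs y" "length xs = Suc k" "set xs \<subseteq> X" "y \<in> Y"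
    by (auto simp: words_def)
  then obtain x ys where x: "xs = x # ys" by (cases xs) auto
  then have "foldr act ys y \<in> words act k X Y" using xs by (auto simp: words_def)
  moreover have "x \<in> X" "w = act x (foldr act ys y)" using xs x by auto
  ultimately show "w \<in> (\<lambda>(x, w). act x w) ` (X \<times> words act k X Y)" by force
next
  fix w assume "w \<in> (\<lambda>(x, w). act x w) ` (X \<times> words act k X Y)"
  then obtain x v where x: "x \<in> X" "v \<in> words act k X Y" "w = act x v" by auto
  then obtain xs y where xs: "v = foldr act xs y" "length xs = k" "set xs \<subseteq> X" "y \<in> Y"
    by (auto simp: words_def)
  show "w \<in> words act (Suc k) X Y" unfolding words_def
    by (intro CollectI exI[of _ "x # xs"] exI[of _ y]) (use x xs in auto)
qed

lemma finite_words: "finite X \<Longrightarrow> finite Y \<Longrightarrow> finite (words act k X Y)"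
  by (induction k) (auto simp: words_0 words_Suc)

context twmod
begin

section \<open>Bounds for dimensions of spans\<close>

lemma span_dim_finite:
  assumes "finite T"
  shows "finite {card S | S. S \<subseteq> T \<and> F_indep lam act S}" "{card S | S. S \<subseteq> T \<and> F_indep lam act S} \<noteq> {}"
proof -
  have "{card S | S. S \<subseteq> T \<and> F_indep lam act S} \<subseteq> {..card T}" using assms card_mono by auto
  then show "finite {card S | S. S \<subseteq> T \<and> F_indep lam act S}" using finite_subset by blast
  have "F_indep lam act {}" by (simp add: F_indep_def)
  then show "{card S | S. S \<subseteq> T \<and> F_indep lam act S} \<noteq> {}" by blast
qed

lemma span_dim_le:
  assumes T: "finite T" "T \<subseteq> V.span E" and E: "finite E"
  shows "span_dim lam act T \<le> card E"
proof -
  have "card S \<le> card E" if S: "S \<subseteq> T" "F_indep lam act S" for S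
  proof -
    have fS: "finite S" using S T finite_subset by blast
    have "card S \<le> card E"
    proof (rule indep_family_card_le[OF fS _ E, where f = "\<lambda>s. s"])
      show "\<forall>i\<in>S. c i = 0" if "(\<Sum>i\<in>S. scl (c i) i) = 0" for c
        by (rule S(2)[unfolded F_indep_def, THEN spec, THEN mp, OF that])
    qed (use S T in auto)
    then show ?thesis .
  qed
  then show ?thesis unfolding span_dim_def
    using span_dim_finite[OF T(1)] by (subst Max_le_iff) auto
qed

lemma span_dim_ge:
  assumes T: "finite T" and I: "finite I" "f ` I \<subseteq> T"
    and ind: "\<And>c. (\<Sum>i\<in>I. scl (c i) (f i)) = 0 \<Longrightarrow> \<forall>i\<in>I. c i = 0"
  shows "card I \<le> span_dim lam act T"
proof -
  have inj: "inj_on f I" by (rule indep_family_inj[OF I(1) ind])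
  have "F_indep lam act (f ` I)"
    unfolding F_indep_def
  proof (intro allI impI)
    fix u assume "(\<Sum>s\<in>f ` I. scl (u s) s) = 0"
    then have "(\<Sum>i\<in>I. scl (u (f i)) (f i)) = 0" by (simp add: sum.reindex[OF inj])
    then have "\<forall>i\<in>I. u (f i) = 0" by (rule ind)
    then show "\<forall>s\<in>f ` I. u s = 0" by blast
  qed
  then have "card (f ` I) \<le> span_dim lam act T" unfolding span_dim_def
    using span_dim_finite[OF T] I by (intro Max_ge) auto
  then show ?thesis by (simp add: card_image[OF inj])
qed

end

text \<open>To apply \<open>U a\<close> to \<open>U c g\<close>, move it past \<open>U c\<close> at
  the cost of a scalar and use that \<open>U a g\<close> is in the span over \<open>Q\<close>. Each
  letter thus costs one summand from \<open>Q\<close>, wherever \<open>a\<close> lies; the starting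
  vectors account for the additional one.\<close>

lemma (in twmod) words_subset_bspan:
  assumes XU: "X \<subseteq> twalg UNIV" and Q: "0 \<in> Q" and Y: "Y \<subseteq> bspan Q G"
    and XQ: "\<And>x a g. x \<in> X \<Longrightarrow> a \<in> fsupp x \<Longrightarrow> g \<in> G \<Longrightarrow> U a g \<in> bspan Q G"
  shows "words act k X Y \<subseteq> bspan (nsum Q (Suc k)) G"
proof (induction k)
  case 0
  have "nsum Q (Suc 0) = Q" by force
  then show ?case using Y by (simp add: words_0 del: nsum.simps)
next
  case (Suc k)
  let ?D = "nsum Q (Suc k)" and ?E = "nsum Q (Suc (Suc k))"
  have "act x w \<in> bspan ?E G" if x: "x \<in> X" and w: "w \<in> words act k X Y" for x w
  proof -
    have xU: "finite (fsupp x)" using x XU by (auto simp: twalg_def)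
    have "U a w \<in> bspan ?E G" if a: "a \<in> fsupp x" for a
    proof -
      have "w \<in> bspan ?D G" using w Suc by blast
      then have "w \<in> {m. U a m \<in> bspan ?E G}"
      proof (rule bspan_induct)
        show "V.subspace {m. U a m \<in> bspan ?E G}" by (intro subspace_U_vimage subspace_bspan)
        fix c g assume c: "c \<in> ?D" and g: "g \<in> G"
        have "U c (U a g) \<in> bspan ?E G"
          by (rule U_bspan[OF XQ[OF x a g]]) (rule nsum_Suc_I[OF c])
        then show "U c g \<in> {m. U a m \<in> bspan ?E G}"
          unfolding mem_Collect_eq U_comm[of a c] by (intro V.subspace_scale subspace_bspan)
      qed
      then show ?thesis by simp
    qed
    then show ?thesis unfolding act_eq[OF xU order_refl]
      by (intro V.subspace_sum V.subspace_scale subspace_bspan)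
  qed
  then show ?case unfolding words_Suc by auto
qed

lemma GKdim_le:
  fixes lam :: "int ^ 'n \<Rightarrow> int ^ 'n \<Rightarrow> 'k::field" and act :: "(int ^ 'n \<Rightarrow> 'k) \<Rightarrow> 'm::ab_group_add \<Rightarrow> 'm"
  assumes "twmod lam act" and C: "is_subgroup C" and G: "finite G" and gen: "twmod.bspan lam act C G = UNIV"
  shows "GKdim lam act \<le> ereal (real (tf_rank C))"
proof -
  interpret twmod lam act by (rule assms(1))
  have "limsup (\<lambda>k. ereal (ln (real (span_dim lam act (words act k X Y))) / ln (real k))) \<le> ereal (real (tf_rank C))"
    if X: "finite X" "X \<subseteq> twalg UNIV" and Y: "finite Y" for X Y
  proof -
    \<comment> \<open>One finite \<open>Q\<close> has to describe both the starting vectors and the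
      effect of every letter on the generators.\<close>
    define W where "W = Y \<union> gens (\<Union>x\<in>X. fsupp x) G"
    have "finite (\<Union>x\<in>X. fsupp x)" using X by (auto simp: twalg_def)
    then have fW: "finite W" unfolding W_def using Y G by (auto intro: finite_gens)
    obtain Q where Q: "finite Q" "0 \<in> Q" "Q \<subseteq> C" "W \<subseteq> bspan Q G"
      using bspan_finite_set[OF fW _ is_subgroup_zero[OF C], of G] gen by auto
    obtain K where K: "\<And>k. card (nsum Q k) \<le> K * (k + 1) ^ tf_rank C" using nsum_growth[OF Q(1,3)] by blast
    have sub: "words act k X Y \<subseteq> bspan (nsum Q (Suc k)) G" for k
    proof (rule words_subset_bspan[OF X(2) Q(2)])
      show "Y \<subseteq> bspan Q G" using Q(4) by (simp add: W_def)
      show "U a g \<in> bspan Q G" if "x \<in> X" "a \<in> fsupp x" "g \<in> G" for x a g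
        using Q(4) that unfolding W_def gens_def by auto
    qed
    have "span_dim lam act (words act k X Y) \<le> (K * 2 ^ tf_rank C * card G) * (k + 1) ^ tf_rank C" for k
    proof -
      have "span_dim lam act (words act k X Y) \<le> card (gens (nsum Q (Suc k)) G)"
        using sub[of k] X Y G Q
        by (intro span_dim_le finite_words finite_gens finite_nsum) (simp_all add: bspan_def del: nsum.simps)
      also have "\<dots> \<le> card (nsum Q (Suc k)) * card G" using Q G by (intro card_gens_le finite_nsum)
      also have "\<dots> \<le> (K * (Suc k + 1) ^ tf_rank C) * card G" by (intro mult_right_mono K) simp
      \<comment> \<open>The factor 2 absorbs the shift by one summand.\<close>
      also have "\<dots> \<le> (K * (2 * (k + 1)) ^ tf_rank C) * card G"
        by (intro mult_right_mono mult_left_mono power_mono) auto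
      also have "\<dots> = (K * 2 ^ tf_rank C * card G) * (k + 1) ^ tf_rank C"
        by (simp only: power_mult_distrib ac_simps)
      finally show ?thesis .
    qed
    then show ?thesis by (rule limsup_growth_le)
  qed
  then show ?thesis unfolding GKdim_def by (intro SUP_least) auto
qed

text \<open>With the identity and the basis elements of a maximal independent set as letters, words
  of length \<open>k\<close> reach multiples of \<open>U p m\<close> for all \<open>p\<close> in a
  box of side proportional to \<open>k\<close>. Torsion-freeness makes these independent over
  F.\<close>

lemma GKdim_ge:
  fixes lam :: "int ^ 'n \<Rightarrow> int ^ 'n \<Rightarrow> 'k::field" and act :: "(int ^ 'n \<Rightarrow> 'k) \<Rightarrow> 'm::ab_group_add \<Rightarrow> 'm"
    and m :: 'm
  assumes "twmod lam act" and C: "is_subgroup C" and tf: "torsion_free act (twalg C)" and m: "m \<noteq> 0"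
  shows "ereal (real (tf_rank C)) \<le> GKdim lam act"
proof -
  interpret twmod lam act by (rule assms(1))
  obtain S where S: "finite S" "S \<subseteq> C" "zindep S" "card S = tf_rank C" using tf_rank_witness by blast
  define X where "X = insert (tw_one lam) (bas ` S)"
  have X: "finite X" "X \<subseteq> twalg UNIV" "tw_one lam \<in> X" using S by (auto simp: X_def)
  \<comment> \<open>The unspecified scalar absorbs the cocycle values that multiplication produces;
    being nonzero, it does not affect independence.\<close>
  define W where "W k = {p \<in> C. \<exists>w\<in>words act k X {m}. \<exists>c. c \<noteq> 0 \<and> w = scl c (U p m)}" for k
  have W0: "0 \<in> W 0"
    unfolding W_def using is_subgroup_zero[OF C]
    by (auto simp: words_0 U_0_left intro!: exI[of _ "inverse (lam 0 0)"])
  \<comment> \<open>The identity among the letters pads shorter words, so \<open>W\<close> increases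
    with the length.\<close>
  have WSuc: "p \<in> W (Suc k)" if p: "p \<in> W k" for p k
  proof -
    obtain w c where w: "p \<in> C" "w \<in> words act k X {m}" "c \<noteq> 0" "w = scl c (U p m)" using p unfolding W_def by blast
    have "act (tw_one lam) w \<in> words act (Suc k) X {m}" unfolding words_Suc using X w by force
    then show ?thesis using w unfolding W_def by auto
  qed
  have Wadd: "s + p \<in> W (Suc k)" if p: "p \<in> W k" and s: "s \<in> S" for p k s
  proof -
    obtain w c where w: "p \<in> C" "w \<in> words act k X {m}" "c \<noteq> 0" "w = scl c (U p m)" using p unfolding W_def by blast
    have "bas s \<in> X" using s by (simp add: X_def)
    then have "act (bas s) w \<in> words act (Suc k) X {m}" unfolding words_Suc using w by force
    moreover have "act (bas s) w = scl (c * lam s p) (U (s + p) m)"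
      unfolding U_def[symmetric] w(4) by (simp add: U_scl U_U)
    moreover have "s + p \<in> C" using S s w C by (auto intro: is_subgroup_add)
    moreover have "c * lam s p \<noteq> 0" using w by simp
    ultimately show ?thesis unfolding W_def by blast
  qed
  have Wmono: "p \<in> W (k + i)" if "p \<in> W k" for p k i
    by (induction i) (use that WSuc in auto)
  have Wmult: "int i *s s + p \<in> W (k + i)" if p: "p \<in> W k" and s: "s \<in> S" for p k s i
  proof (induction i)
    case 0
    have "int 0 *s s = 0" by (simp add: vec_eq_iff)
    then show ?case using p by simp
  next
    case (Suc i)
    have "int (Suc i) *s s + p = s + (int i *s s + p)" by (simp add: vec_eq_iff algebra_simps)
    then show ?case using Wadd[OF Suc s] by (simp only: add_Suc_right)
  qed
  have Wsum: "(\<Sum>s\<in>S'. f s *s s) \<in> W (card S' * j)"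
    if S': "S' \<subseteq> S" and f: "\<And>s. s \<in> S \<Longrightarrow> 0 \<le> f s \<and> f s \<le> int j" for S' f j
    using finite_subset[OF S' S(1)] S'
  proof (induction S' rule: finite_induct)
    case empty
    then show ?case using W0 by simp
  next
    case (insert s S')
    define i where "i = nat (f s)"
    have i: "f s = int i" "i \<le> j" using f[of s] insert.prems by (auto simp: i_def)
    have "int i *s s + (\<Sum>s\<in>S'. f s *s s) \<in> W (card S' * j + i)"
      using insert by (intro Wmult) auto
    then have "int i *s s + (\<Sum>s\<in>S'. f s *s s) \<in> W (card S' * j + i + (j - i))" by (rule Wmono)
    then show ?case using insert.hyps i by (simp add: add.commute)
  qed
  \<comment> \<open>The rank plus 1 is used so that the divisor stays positive for rank 0.\<close>
  let ?e = "Suc (tf_rank C)"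
  have low: "(k div ?e) ^ tf_rank C \<le> span_dim lam act (words act k X {m})" for k
  proof -
    define j where "j = k div ?e"
    have jk: "card S * j \<le> k"
    proof -
      have "card S * j \<le> ?e * j" using S(4) by simp
      also have "\<dots> \<le> k" unfolding j_def by (rule times_div_less_eq_dividend)
      finally show ?thesis .
    qed
    let ?P = "S \<rightarrow>\<^sub>E {0..int j}"
    define D where "D = (\<lambda>f. \<Sum>s\<in>S. f s *s s) ` ?P"
    have fP: "finite ?P" using S by (intro finite_PiE) auto
    have fD: "finite D" unfolding D_def using fP by (rule finite_imageI)
    have "card D = card ?P" unfolding D_def by (rule card_image[OF zindep_inj_on[OF S(3,1)]])
    also have "\<dots> = Suc j ^ tf_rank C" using S by (simp add: card_PiE nat_add_distrib)
    finally have cD: "card D = Suc j ^ tf_rank C" .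
    have DW: "p \<in> W k" if "p \<in> D" for p
    proof -
      obtain f where f: "f \<in> ?P" "p = (\<Sum>s\<in>S. f s *s s)" using \<open>p \<in> D\<close> unfolding D_def by blast
      have "p \<in> W (card S * j)" unfolding f(2) using f(1) by (intro Wsum) (auto simp: PiE_def Pi_def)
      then have "p \<in> W (card S * j + (k - card S * j))" by (rule Wmono)
      then show ?thesis using jk by simp
    qed
    then have "\<forall>p\<in>D. \<exists>w c. w \<in> words act k X {m} \<and> c \<noteq> 0 \<and> w = scl c (U p m)" unfolding W_def by blast
    then obtain w c where wc: "\<And>p. p \<in> D \<Longrightarrow> w p \<in> words act k X {m} \<and> c p \<noteq> 0 \<and> w p = scl (c p) (U p m)" by metis
    have DC: "D \<subseteq> C" using DW unfolding W_def by blast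
    have "card D \<le> span_dim lam act (words act k X {m})"
    proof (rule span_dim_ge[OF _ fD, where f = w])
      show "finite (words act k X {m})" using X by (intro finite_words) auto
      show "w ` D \<subseteq> words act k X {m}" using wc by blast
      fix u assume u: "(\<Sum>p\<in>D. scl (u p) (w p)) = 0"
      \<comment> \<open>A relation among the words, with the scalars \<open>c p\<close> absorbed, is
        one element of F*C that kills \<open>m\<close>.\<close>
      define x where "x = (\<lambda>p. if p \<in> D then u p * c p else 0)"
      have xC: "x \<in> twalg C" by (rule twalgI_finite[OF fD DC]) (simp add: x_def)
      have "act x m = (\<Sum>p\<in>D. scl (x p) (U p m))" by (rule act_eq[OF fD]) (auto simp: fsupp_def x_def)
      also have "\<dots> = (\<Sum>p\<in>D. scl (u p) (w p))"
        using wc by (intro sum.cong refl) (simp add: x_def)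
      finally have "act x m = 0" using u by simp
      then have "x = (\<lambda>_. 0)" using tf xC m unfolding torsion_free_def by auto
      then have "x p = 0" for p by simp
      then show "\<forall>p\<in>D. u p = 0" using wc unfolding x_def by (metis mult_eq_0_iff)
    qed
    moreover have "j ^ tf_rank C \<le> Suc j ^ tf_rank C" by (intro power_mono) auto
    ultimately show ?thesis using cD unfolding j_def by linarith
  qed
  have "ereal (real (tf_rank C)) \<le> limsup (\<lambda>k. ereal (ln (real (span_dim lam act (words act k X {m}))) / ln (real k)))"
    by (rule limsup_growth_ge[OF _ low]) simp
  also have "\<dots> \<le> GKdim lam act" unfolding GKdim_def
    by (rule SUP_upper2[of "(X, {m})"]) (use X in auto)
  finally show ?thesis .
qed

theorem theoremA:
  fixes lam :: "int ^ 'n \<Rightarrow> int ^ 'n \<Rightarrow> 'k::field"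
    and act :: "(int ^ 'n \<Rightarrow> 'k) \<Rightarrow> 'm::ab_group_add \<Rightarrow> 'm"
    and C C0 :: "(int ^ 'n) set"
  assumes cocycle: "two_cocycle lam"
    and center: "tw_center lam = {z. \<forall>a. a \<noteq> 0 \<longrightarrow> z a = 0}"
    and C_sub: "is_subgroup C" and C_proper: "C \<noteq> UNIV"
    and C0_sub: "is_subgroup C0" and C0_C: "C0 \<subseteq> C" and C0_fi: "finite_index C0 C"
    and C0_comm: "\<forall>x\<in>twalg C0. \<forall>y\<in>twalg C0. tw_mult lam x y = tw_mult lam y x"
    and M_mod: "tw_module lam act"
    and M_nonzero: "\<exists>m::'m. m \<noteq> 0"
    and M_fg: "fin_gen act (twalg UNIV)"
    and M_fgC: "fin_gen act (twalg C)"
  shows "GKdim lam act = ereal (real (tf_rank C))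
    \<and> torsion_free act (twalg C)
    \<and> artinian_mod act (twalg UNIV)
    \<and> cyclic_mod act (twalg UNIV)"
proof -
  interpret twmod lam act by unfold_locales (rule cocycle, rule M_mod)
  obtain G where CG: "finite G" "bspan C G = UNIV"
    using M_fgC unfolding fin_gen_def gen_submod_eq[OF C_sub] by blast
  obtain T where T: "finite T" "T \<subseteq> C" "\<And>c. c \<in> C \<Longrightarrow> \<exists>t\<in>T. c - t \<in> C0"
    "\<And>s t. s \<in> T \<Longrightarrow> t \<in> T \<Longrightarrow> s - t \<in> C0 \<Longrightarrow> s = t"
    using finite_index_transversal[OF C0_sub C0_fi] by blast
  have nd: "b = 0" if "\<And>a. lam a b = lam b a" for b by (rule central_basis_element[OF center that])
  have cm: "lam a b = lam b a" if "a \<in> C0" "b \<in> C0" for a b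
    by (rule lam_commute_of_tw_mult_commute[OF C0_comm that])
  have "bspan C G \<subseteq> bspan C0 (gens T G)" by (rule bspan_finite_index) (rule T(3))
  then have gen0: "bspan C0 (gens T G) = UNIV" using CG(2) by blast
  \<comment> \<open>The rank theory runs over C_0, where the translates of \<open>G\<close> by the
    transversal generate M. Torsion-freeness is then carried back to F*C, and the growth bounds use
    C directly.\<close>
  interpret fg_comm_module lam act C0 "gens T G"
    by unfold_locales
      (fact nd dom_alg_int_vec[OF cocycle] slow_growth_int_vec C0_sub cm finite_gens[OF T(1) CG(1)] gen0)+
  have tf: "torsion_free act (twalg C)"
    by (rule torsion_free_finite_index[OF C_sub C0_C T])
  obtain m :: 'm where m: "m \<noteq> 0" using M_nonzero by blast
  have "GKdim lam act = ereal (real (tf_rank C))"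
    by (rule antisym[OF GKdim_le[OF twmod_axioms C_sub CG] GKdim_ge[OF twmod_axioms C_sub tf m]])
  moreover have "cyclic_mod act (twalg UNIV)"
    by (rule cyclic[OF commutative_infinite_index[OF cocycle nd C0_sub cm]])
  ultimately show ?thesis using tf artinian by blast
qed

end
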